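(* Let $\tau>0$ be fixed. The following asymptotics hold as the order $n$ of the graph tends to infinity: (a) Empty graph $E_n$: $S(\varrho^\tau_{A(E_n)})=\log n-o(1)$ and $S(\varrho^\tau_{L(E_n)})=\log n-o(1)$. (b) Complete graph $K_n$: $S(\varrho^\tau_{A(K_n)})=o(1)$, $S(\varrho^\tau_{L(K_n)})=o(1)$, and $S(\varrho^\tau_{\mathcal L(K_n)})=\log n-o(1)$. (c) Complete bipartite graph $K_{n_1,n_2}$ (with $n_1,n_2\ge1$ and $n=n_1+n_2\to\infty$): $S(\varrho^\tau_{A(K_{n_1,n_2})})=o(1)$. (d) Balanced complete bipartite graph $K_{n_1,n_1}$ (with $n=2n_1$): $S(\varrho^\tau_{A(K_{n_1,n_1})})=o(1)$, $S(\varrho^\tau_{L(K_{n_1,n_1})})=o(1)$, and $S(\varrho^\tau_{\mathcal L(K_{n_1,n_1})})=\log n-o(1)$. (e) Star graph $K_{n_1,1}$ (with $n=n_1+1$): $S(\varrho^\tau_{A(K_{n_1,1})})=o(1)$, $S(\varrho^\tau_{L(K_{n_1,1})})=\log n-o(1)$, and $S(\varrho^\tau_{\mathcal L(K_{n_1,1})})=\log n-o(1)$. (f) Cycle graph $C_n$: $S(\varrho^\tau_{A(C_n)})=\log n-\Theta(1)$, $S(\varrho^\tau_{L(C_n)})=\log n-\Theta(1)$, and $S(\varrho^\tau_{\mathcal L(C_n)})=\log n-\Theta(1)$.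
   Context: For a simple undirected graph $G$, $A(G)$ is the adjacency matrix, $D(G)$ the diagonal degree matrix, $L(G)=D(G)-A(G)$ the Laplacian, and $\mathcal L(G)=D(G)^{-1/2}L(G)D(G)^{-1/2}$ the normalized Laplacian. For a Hermitian matrix $H$ and real $\tau$, the Gibbs state is $\varrho_H^\tau=\exp(-\tau H)/\mathrm{Tr}(\exp(-\tau H))$, and $S(\varrho)=-\mathrm{Tr}(\varrho\log\varrho)$ is the von Neumann entropy (natural logarithm). Convention for adjacency matrices: $S(\varrho_{A(G)}^\tau)$ denotes the entropy of the Gibbs state with $H=-A(G)$, i.e. of $\exp(\tau A(G))/\mathrm{Tr}(\exp(\tau A(G)))$; for $L(G)$ and $\mathcal L(G)$ one takes $H=L(G)$ and $H=\mathcal L(G)$ respectively. $E_n$ is the graph on $n$ vertices with no edges; $K_n$ is the complete graph; $K_{n_1,n_2}$ is the complete bipartite graph with parts of sizes $n_1,n_2$; $C_n$ is the cycle on $n$ vertices. $o(1)$ denotes a quantity (of any sign) converging to $0$; $\Theta(1)$ denotes a quantity whose absolute value lies between two positive constants (independent of $n$) for all sufficiently large $n$. *)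

theory Defs
  imports
    "Jordan_Normal_Form.Schur_Decomposition"
    "HOL-Library.Landau_Symbols"
    Complex_Main
begin

section \<open>Simple undirected graphs\<close>

text \<open>The vertices are the numbers below \<open>order_of G\<close>; an edge is a two-element set of vertices.\<close>

record ugraph =
  order_of :: nat
  edges :: "nat set set"

definition simple_graph :: "ugraph \<Rightarrow> bool" where
  "simple_graph G \<longleftrightarrow> (\<forall>e\<in>edges G. e \<subseteq> {..<order_of G} \<and> card e = 2)"

definition degree_of :: "ugraph \<Rightarrow> nat \<Rightarrow> nat" where
  "degree_of G i = card {j. j < order_of G \<and> {i, j} \<in> edges G}"

definition empty_graph :: "nat \<Rightarrow> ugraph" where
  "empty_graph n = \<lparr>order_of = n, edges = {}\<rparr>"

definition complete_graph :: "nat \<Rightarrow> ugraph" where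
  "complete_graph n = \<lparr>order_of = n, edges = {{i, j} |i j. i < n \<and> j < n \<and> i \<noteq> j}\<rparr>"

definition complete_bipartite :: "nat \<Rightarrow> nat \<Rightarrow> ugraph" where
  "complete_bipartite n1 n2 =
     \<lparr>order_of = n1 + n2, edges = {{i, j} |i j. i < n1 \<and> n1 \<le> j \<and> j < n1 + n2}\<rparr>"

text \<open>This is the cycle only for \<open>n \<ge> 3\<close>, which suffices for limits as \<open>n\<close> tends to infinity.\<close>

definition cycle_graph :: "nat \<Rightarrow> ugraph" where
  "cycle_graph n = \<lparr>order_of = n, edges = {{i, (i + 1) mod n} |i. i < n}\<rparr>"

lemma simple_empty_graph: "simple_graph (empty_graph n)"
  by (simp add: simple_graph_def empty_graph_def)

lemma simple_complete_graph: "simple_graph (complete_graph n)"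
  by (auto simp: simple_graph_def complete_graph_def)

lemma simple_complete_bipartite: "simple_graph (complete_bipartite n1 n2)"
  by (auto simp: simple_graph_def complete_bipartite_def card_2_iff)
    (metis linorder_not_less)

lemma simple_cycle_graph:
  assumes "n \<ge> 3"
  shows "simple_graph (cycle_graph n)"
proof -
  have "Suc i mod n \<noteq> i" if "i < n" for i
    using that assms by (cases "Suc i = n") auto
  then show ?thesis
    using assms by (fastforce simp: simple_graph_def cycle_graph_def card_2_iff)
qed


section \<open>Matrices of a graph\<close>

definition adjacency_matrix :: "ugraph \<Rightarrow> complex mat" where
  "adjacency_matrix G =
     mat (order_of G) (order_of G) (\<lambda>(i, j). if {i, j} \<in> edges G then 1 else 0)"

definition degree_matrix :: "ugraph \<Rightarrow> complex mat" where
  "degree_matrix G = mat_diag (order_of G) (\<lambda>i. of_nat (degree_of G i))"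

definition laplacian :: "ugraph \<Rightarrow> complex mat" where
  "laplacian G = degree_matrix G - adjacency_matrix G"

text \<open>Since \<open>1 / 0 = 0\<close>, isolated vertices get the entry \<open>0\<close>, which is the usual convention.\<close>

definition degree_matrix_inv_sqrt :: "ugraph \<Rightarrow> complex mat" where
  "degree_matrix_inv_sqrt G =
     mat_diag (order_of G) (\<lambda>i. complex_of_real (1 / sqrt (real (degree_of G i))))"

definition normalized_laplacian :: "ugraph \<Rightarrow> complex mat" where
  "normalized_laplacian G = degree_matrix_inv_sqrt G * laplacian G * degree_matrix_inv_sqrt G"


section \<open>Matrix functions, Gibbs states and von Neumann entropy\<close>

definition mat_trace :: "complex mat \<Rightarrow> complex" where
  "mat_trace A = (\<Sum>i<dim_row A. A $$ (i, i))"

text \<open>The power series of the exponential, which converges entrywise for every square matrix.\<close>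

definition mat_exp :: "complex mat \<Rightarrow> complex mat" where
  "mat_exp A = mat (dim_row A) (dim_row A) (\<lambda>(i, j). \<Sum>k. (A ^\<^sub>m k) $$ (i, j) / fact k)"

definition unitary_mat :: "nat \<Rightarrow> complex mat \<Rightarrow> bool" where
  "unitary_mat n U \<longleftrightarrow>
     U \<in> carrier_mat n n \<and> U * mat_adjoint U = 1\<^sub>m n \<and> mat_adjoint U * U = 1\<^sub>m n"

text \<open>\<open>spectral_decomp A U d\<close> says that the columns of \<open>U\<close> form an orthonormal basis of
  eigenvectors of \<open>A\<close>, with real eigenvalues \<open>d 0, d 1, \<dots>\<close>; it is satisfiable by \<open>U\<close> and \<open>d\<close>
  exactly if \<open>A\<close> is Hermitian.\<close>

definition spectral_decomp :: "complex mat \<Rightarrow> complex mat \<Rightarrow> (nat \<Rightarrow> real) \<Rightarrow> bool" where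
  "spectral_decomp A U d \<longleftrightarrow>
     unitary_mat (dim_row A) U \<and>
     A = U * mat_diag (dim_row A) (\<lambda>i. complex_of_real (d i)) * mat_adjoint U"

text \<open>The functional calculus for Hermitian matrices; \<open>hermitian_fun_eq\<close> below shows that the
  value does not depend on the decomposition.\<close>

definition hermitian_fun :: "(real \<Rightarrow> real) \<Rightarrow> complex mat \<Rightarrow> complex mat" where
  "hermitian_fun f A =
     (THE B. \<exists>U d. spectral_decomp A U d \<and>
        B = U * mat_diag (dim_row A) (\<lambda>i. complex_of_real (f (d i))) * mat_adjoint U)"

definition gibbs_state :: "real \<Rightarrow> complex mat \<Rightarrow> complex mat" where
  "gibbs_state \<tau> H =
     (1 / mat_trace (mat_exp (complex_of_real (- \<tau>) \<cdot>\<^sub>m H))) \<cdot>\<^sub>m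
       mat_exp (complex_of_real (- \<tau>) \<cdot>\<^sub>m H)"

text \<open>The trace is real for a density matrix; \<open>Re\<close> only changes its type. Since \<open>ln 0 = 0\<close>,
  the convention \<open>0 log 0 = 0\<close> holds.\<close>

definition von_neumann_entropy :: "complex mat \<Rightarrow> real" where
  "von_neumann_entropy \<rho> = Re (- mat_trace (\<rho> * hermitian_fun ln \<rho>))"

text \<open>For adjacency matrices the Hamiltonian is \<open>- A(G)\<close>, so the state is proportional to
  \<open>exp (\<tau> A(G))\<close>.\<close>

definition entropy_adj :: "real \<Rightarrow> ugraph \<Rightarrow> real" where
  "entropy_adj \<tau> G = von_neumann_entropy (gibbs_state \<tau> (- adjacency_matrix G))"

definition entropy_lap :: "real \<Rightarrow> ugraph \<Rightarrow> real" where
  "entropy_lap \<tau> G = von_neumann_entropy (gibbs_state \<tau> (laplacian G))"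

definition entropy_nlap :: "real \<Rightarrow> ugraph \<Rightarrow> real" where
  "entropy_nlap \<tau> G = von_neumann_entropy (gibbs_state \<tau> (normalized_laplacian G))"


section \<open>Well-definedness of the functional calculus\<close>

lemma mat_adjoint_carrier:
  "A \<in> carrier_mat m n \<Longrightarrow> (mat_adjoint A :: complex mat) \<in> carrier_mat n m"
  by (auto simp: mat_adjoint_def mat_of_rows_def)

lemma hermitian_fun_unique:
  assumes dec: "spectral_decomp A U d" "spectral_decomp A V e"
  shows "U * mat_diag (dim_row A) (\<lambda>i. complex_of_real (f (d i))) * mat_adjoint U =
         V * mat_diag (dim_row A) (\<lambda>i. complex_of_real (f (e i))) * mat_adjoint V"
proof -
  define n where "n = dim_row A"
  define D where "D g = mat_diag n (\<lambda>i. complex_of_real (g (d i)))" for g :: "real \<Rightarrow> real"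
  define E where "E g = mat_diag n (\<lambda>i. complex_of_real (g (e i)))" for g :: "real \<Rightarrow> real"
  define Ua where "Ua = mat_adjoint U"
  define Va where "Va = mat_adjoint V"
  define W where "W = Va * U"
  have [simp]: "D g \<in> carrier_mat n n" "E g \<in> carrier_mat n n" for g
    by (auto simp: D_def E_def)
  have cU [simp]: "U \<in> carrier_mat n n" and cV [simp]: "V \<in> carrier_mat n n"
    using dec by (auto simp: spectral_decomp_def unitary_mat_def n_def)
  have [simp]: "Ua \<in> carrier_mat n n" "Va \<in> carrier_mat n n"
    by (simp_all add: Ua_def Va_def mat_adjoint_carrier)
  have cW [simp]: "W \<in> carrier_mat n n"
    unfolding W_def by (rule mult_carrier_mat[of _ n n]) auto
  have UaU: "Ua * U = 1\<^sub>m n" and UUa: "U * Ua = 1\<^sub>m n"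
    and VaV: "Va * V = 1\<^sub>m n" and VVa: "V * Va = 1\<^sub>m n"
    using dec by (auto simp: spectral_decomp_def unitary_mat_def n_def Ua_def Va_def)
  have AU: "A = U * D id * Ua" and AV: "A = V * E id * Va"
    using dec by (auto simp: spectral_decomp_def D_def E_def n_def Ua_def Va_def)
  note mc = mult_carrier_mat[of _ n n _ n]
  note as = assoc_mult_mat[of _ n n _ n _ n]
  have "W * D id = Va * (U * D id * (Ua * U))"
    unfolding W_def UaU by (simp add: as mc right_mult_one_mat[of _ n n])
  also have "\<dots> = Va * (U * D id * Ua) * U"
    by (simp add: as mc)
  also have "\<dots> = Va * (V * E id * Va) * U"
    using AU AV by simp
  also have "\<dots> = (Va * V) * E id * (Va * U)"
    by (simp add: as mc)
  also have "\<dots> = E id * W"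
    unfolding VaV W_def[symmetric] by (simp add: left_mult_one_mat[of _ n n])
  finally have eq: "W * D id = E id * W" .
  have ent: "W $$ (i, j) * complex_of_real (d j) = complex_of_real (e i) * W $$ (i, j)"
    if "i < n" "j < n" for i j
    using arg_cong[OF eq, of "\<lambda>M. M $$ (i, j)"] that
    by (simp add: D_def E_def mat_diag_mult_right[OF cW] mat_diag_mult_left[OF cW])
  have ent': "W $$ (i, j) * complex_of_real (f (d j)) = complex_of_real (f (e i)) * W $$ (i, j)"
    if "i < n" "j < n" for i j
    using ent[OF that] by (cases "W $$ (i, j) = 0") (auto simp: mult.commute)
  have eqf: "W * D f = E f * W"
    by (rule eq_matI)
      (auto simp: D_def E_def mat_diag_mult_right[OF cW] mat_diag_mult_left[OF cW] ent')
  have "U * D f * Ua = (V * Va) * (U * D f * Ua)"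
    unfolding VVa by (rule left_mult_one_mat[symmetric, of _ n n]) (simp add: mc)
  also have "\<dots> = V * (W * D f) * Ua"
    by (simp add: as mc W_def)
  also have "\<dots> = V * E f * Va * (U * Ua)"
    unfolding eqf by (simp add: as mc W_def)
  also have "\<dots> = V * E f * Va"
    unfolding UUa by (simp add: mc right_mult_one_mat[of _ n n])
  finally show ?thesis
    by (simp add: D_def E_def n_def Ua_def Va_def)
qed

lemma hermitian_fun_eq:
  assumes "spectral_decomp A U d"
  shows "hermitian_fun f A =
    U * mat_diag (dim_row A) (\<lambda>i. complex_of_real (f (d i))) * mat_adjoint U"
  unfolding hermitian_fun_def
  by (rule the_equality) (use assms hermitian_fun_unique in blast)+

end

theory Submission
  imports Defs "Jordan_Normal_Form.Spectral_Radius" "HOL-Real_Asymp.Real_Asymp"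
begin

text \<open>
  A Hermitian matrix \<open>H\<close> with eigenvalues \<open>d 0, d 1, \<dots>\<close> has a Gibbs state with eigenvalues
  \<open>exp (- \<tau> d i) / Z\<close> in the same eigenbasis, so its entropy depends on the eigenvalues alone:
  it is \<open>ln Z + \<tau> (\<Sum>i. d i exp (- \<tau> d i)) / Z\<close>. The existence of the eigenbasis is
  \<open>spectral_decomp_exists\<close>, and the entropy formula is \<open>von_neumann_entropy_gibbs_state\<close>.

  A Gibbs state does not change if a multiple of the identity is added to \<open>H\<close>. For a \<open>k\<close>-regular
  graph \<open>L = k I - A\<close>, and \<open>\<L> = I - A / q\<close> whenever the product of the degrees is \<open>q\<^sup>2\<close> along
  every edge (regular and complete bipartite graphs). Hence all entropies except that of the
  Laplacian of a star are entropies of an adjacency matrix at some inverse temperature.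

  For the complete graph, the complete bipartite graphs and the Laplacian of the star, one or two
  eigenvectors are evident, and the remaining eigenvalues all equal one number \<open>c\<close>. This last fact
  follows from the second moment: the sum of \<open>(d i - c)\<^sup>2\<close> over all \<open>i\<close> is the sum of the squared
  entries of \<open>H - c I\<close>, and it is already exhausted by the evident eigenvalues
  (\<open>spectral_decomp_few_levels\<close>). The entropies are then explicit functions of \<open>n\<close>. They tend to
  \<open>0\<close> if the ground state is separated from the others by a gap that grows faster than \<open>ln n\<close>,
  and the deficit \<open>ln n - S\<close> tends to \<open>0\<close> if all but a bounded number of eigenvalues agree and the
  others do not gain weight.

  For the cycle the spectrum itself is not needed. Its adjacency eigenvalues lie in \<open>[-2, 2]\<close> and
  have mean \<open>0\<close> and mean square \<open>2\<close>. The deficit \<open>ln n - S\<close> is the relative entropy of the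
  eigenvalue distribution of the state with respect to the uniform one; boundedness of the spectrum
  bounds it above, and the nonzero variance keeps it away from \<open>0\<close> (\<open>entropy_deficit_bounds\<close>).
\<close>

section \<open>The spectral theorem for Hermitian matrices\<close>

lemma mat_adjoint_dim [simp]:
  "dim_row (mat_adjoint (A :: complex mat)) = dim_col A"
  "dim_col (mat_adjoint (A :: complex mat)) = dim_row A"
  by (simp_all add: mat_adjoint_def mat_of_rows_def)

lemma mat_adjoint_index [simp]:
  assumes "i < dim_col A" "j < dim_row A"
  shows "mat_adjoint A $$ (i, j) = cnj (A $$ (j, i))"
  using assms by (simp add: mat_adjoint_def mat_of_rows_def)

lemma mat_adjoint_mult:
  assumes A: "(A :: complex mat) \<in> carrier_mat m k" and B: "B \<in> carrier_mat k n"
  shows "mat_adjoint (A * B) = mat_adjoint B * mat_adjoint A"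
  using A B by (intro eq_matI) (auto simp: scalar_prod_def mult.commute)

lemma mat_adjoint_adjoint: "mat_adjoint (mat_adjoint A) = (A :: complex mat)"
  by (rule eq_matI) auto

lemma unitary_matI:
  assumes U: "U \<in> carrier_mat n n" and "mat_adjoint U * U = 1\<^sub>m n"
  shows "unitary_mat n U"
  using assms mat_mult_left_right_inverse[OF mat_adjoint_carrier[OF U] U]
  by (simp add: unitary_mat_def)

lemma unitary_mat_mult:
  assumes "unitary_mat n U" "unitary_mat n V"
  shows "unitary_mat n (U * V)"
proof (rule unitary_matI)
  from assms have U: "U \<in> carrier_mat n n" and V: "V \<in> carrier_mat n n"
    and UU: "mat_adjoint U * U = 1\<^sub>m n" and VV: "mat_adjoint V * V = 1\<^sub>m n"
    by (auto simp: unitary_mat_def)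
  note Ua = mat_adjoint_carrier[OF U] and Va = mat_adjoint_carrier[OF V]
  show "U * V \<in> carrier_mat n n" using U V by simp
  have "mat_adjoint (U * V) * (U * V) = mat_adjoint V * (mat_adjoint U * U * V)"
    unfolding mat_adjoint_mult[OF U V] using U V Ua Va
    by (simp add: assoc_mult_mat[of _ n n _ n _ n])
  also have "\<dots> = 1\<^sub>m n" using U V Va by (simp add: UU VV)
  finally show "mat_adjoint (U * V) * (U * V) = 1\<^sub>m n" .
qed

text \<open>The characteristic polynomial has a complex root; Gram-Schmidt completes an eigenvector to an
  orthogonal basis, whose vectors only need to be normalised.\<close>

lemma ex_unitary_first_col_eigenvector:
  assumes A: "(A :: complex mat) \<in> carrier_mat n n" and n: "n > 0"
  shows "\<exists>W k. unitary_mat n W \<and> (\<forall>i<n. (A * W) $$ (i, 0) = k * W $$ (i, 0))"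
proof -
  from spectrum_non_empty[OF A n] obtain k v where "eigenvector A v k"
    by (auto simp: spectrum_def eigenvalue_def)
  then have v: "v \<in> carrier_vec n" and v0: "v \<noteq> 0\<^sub>v n" and Av: "A *\<^sub>v v = k \<cdot>\<^sub>v v"
    using A by (auto simp: eigenvector_def)
  interpret cof_vec_space n "TYPE(complex)" .
  define b where "b = basis_completion v"
  define ws where "ws = gram_schmidt n b"
  note bc = basis_completion[OF v v0, folded b_def]
  then obtain vs where bv: "b = v # vs" using n by (cases b) auto
  have ws: "set ws \<subseteq> carrier_vec n" "corthogonal ws" "length ws = n"
    using gram_schmidt_result[OF bc(2,4,5) refl, folded ws_def] bc(6) by auto
  have "hd ws = v" unfolding ws_def bv by (rule gram_schmidt_hd[OF v])
  then have ws0: "ws ! 0 = v" using ws(3) n by (metis hd_conv_nth length_0_conv less_numeral_extra(3))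
  have car: "ws ! j \<in> carrier_vec n" if "j < n" for j using ws that by auto
  define r where "r j = sqrt (\<Sum>i<n. (cmod (ws ! j $ i))\<^sup>2)" for j
  define W where "W = mat n n (\<lambda>(i, j). ws ! j $ i / complex_of_real (r j))"
  have W: "W \<in> carrier_mat n n" by (simp add: W_def)
  have ip: "(ws ! l) \<bullet>c (ws ! j) = (\<Sum>i<n. cnj (ws ! j $ i) * ws ! l $ i)" if "j < n" "l < n" for j l
    using car[OF that(1)] car[OF that(2)]
    by (simp add: scalar_prod_def mult.commute lessThan_atLeast0)
  have diag: "(\<Sum>i<n. cnj (ws ! j $ i) * ws ! j $ i) = complex_of_real (r j) * complex_of_real (r j)" for j
  proof -
    have "complex_of_real (r j) * complex_of_real (r j) = of_real ((r j)\<^sup>2)"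
      by (simp add: power2_eq_square)
    also have "(r j)\<^sup>2 = (\<Sum>i<n. (cmod (ws ! j $ i))\<^sup>2)"
      by (simp add: r_def sum_nonneg)
    also have "of_real \<dots> = (\<Sum>i<n. cnj (ws ! j $ i) * ws ! j $ i)"
      unfolding of_real_sum by (intro sum.cong refl) (simp only: complex_norm_square mult.commute)
    finally show ?thesis by simp
  qed
  have r0: "r j \<noteq> 0" if "j < n" for j
    using corthogonalD[OF ws(2), of j j] that ws(3) ip[OF that that] diag[of j] by auto
  have WW: "mat_adjoint W * W = 1\<^sub>m n"
  proof (rule eq_matI)
    fix j l assume "j < dim_row (1\<^sub>m n)" "l < dim_col (1\<^sub>m n)"
    then have jl: "j < n" "l < n" by auto
    then have "(mat_adjoint W * W) $$ (j, l)
        = (\<Sum>i<n. cnj (ws ! j $ i) * ws ! l $ i) / (of_real (r j) * of_real (r l))"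
      by (simp add: W_def scalar_prod_def sum_divide_distrib lessThan_atLeast0)
    also have "\<dots> = 1\<^sub>m n $$ (j, l)"
      using jl ip[OF jl] corthogonalD[OF ws(2), of l j] ws(3) diag[of j] r0[OF jl(1)]
      by (cases "j = l") auto
    finally show "(mat_adjoint W * W) $$ (j, l) = 1\<^sub>m n $$ (j, l)" .
  qed (use W in auto)
  have "(A * W) $$ (i, 0) = k * W $$ (i, 0)" if "i < n" for i
  proof -
    have "(A * W) $$ (i, 0) = (\<Sum>l<n. A $$ (i, l) * v $ l) / complex_of_real (r 0)"
      using that n A v by (simp add: W_def scalar_prod_def sum_divide_distrib ws0 lessThan_atLeast0)
    also have "(\<Sum>l<n. A $$ (i, l) * v $ l) = (A *\<^sub>v v) $ i"
      using that A v by (simp add: scalar_prod_def lessThan_atLeast0)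
    also have "\<dots> = k * v $ i" unfolding Av using that v by simp
    finally show ?thesis using that n by (simp add: W_def ws0)
  qed
  then show ?thesis using unitary_matI[OF W WW] by blast
qed

text \<open>Induction on the size: in a basis that starts with an eigenvector, the first column is a multiple
  of the first unit vector, hence so is the first row by symmetry, and the remaining block is again
  Hermitian.\<close>

theorem spectral_decomp_exists:
  assumes "A \<in> carrier_mat n n" "mat_adjoint A = A"
  shows "\<exists>U d. spectral_decomp A U d"
  using assms
proof (induction n arbitrary: A)
  case 0
  then have "spectral_decomp A (1\<^sub>m 0) (\<lambda>_. 0)"
    by (auto simp: spectral_decomp_def unitary_mat_def intro!: eq_matI)
  then show ?case by blast
next
  case (Suc n A)
  note A = Suc.prems(1)
  let ?N = "Suc n"
  obtain W k where uW: "unitary_mat ?N W"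
    and col: "\<And>i. i < ?N \<Longrightarrow> (A * W) $$ (i, 0) = k * W $$ (i, 0)"
    using ex_unitary_first_col_eigenvector[OF A] by auto
  from uW have W: "W \<in> carrier_mat ?N ?N" and WW: "mat_adjoint W * W = 1\<^sub>m ?N"
    and WW': "W * mat_adjoint W = 1\<^sub>m ?N" by (auto simp: unitary_mat_def)
  note Wa = mat_adjoint_carrier[OF W]
  define B where "B = mat_adjoint W * (A * W)"
  have B: "B \<in> carrier_mat ?N ?N" using A W Wa by (simp add: B_def)
  have Bh: "mat_adjoint B = B"
    unfolding B_def mat_adjoint_mult[OF Wa mult_carrier_mat[OF A W]] mat_adjoint_mult[OF A W]
      mat_adjoint_adjoint Suc.prems(2)
    using A W Wa by (simp add: assoc_mult_mat[of _ ?N ?N _ ?N _ ?N])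
  have Bcnj: "cnj (B $$ (j, i)) = B $$ (i, j)" if "i < ?N" "j < ?N" for i j
    using mat_adjoint_index[of i B j] B that by (simp add: Bh)
  have B0: "B $$ (i, 0) = (if i = 0 then k else 0)" if "i < ?N" for i
  proof -
    have "B $$ (i, 0) = (\<Sum>l<?N. mat_adjoint W $$ (i, l) * (A * W) $$ (l, 0))"
      using that W A Wa unfolding B_def by (simp add: scalar_prod_def lessThan_atLeast0)
    also have "\<dots> = (\<Sum>l<?N. k * (mat_adjoint W $$ (i, l) * W $$ (l, 0)))"
      by (intro sum.cong) (auto simp: col)
    also have "\<dots> = k * (mat_adjoint W * W) $$ (i, 0)"
      using that W Wa by (simp add: scalar_prod_def lessThan_atLeast0 sum_distrib_left algebra_simps)
    also have "\<dots> = (if i = 0 then k else 0)" unfolding WW using that by auto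
    finally show ?thesis .
  qed
  have B0': "B $$ (0, i) = (if i = 0 then k else 0)" if "i < ?N" for i
    using Bcnj[of 0 i] B0[of i] Bcnj[of 0 0] B0[of 0] that by (auto split: if_splits)
  \<comment> \<open>the top left entry is a diagonal entry of a Hermitian matrix, hence real\<close>
  have kr: "k = complex_of_real (Re k)"
    using Bcnj[of 0 0] B0[of 0] by (simp add: complex_eq_iff)
  define C where "C = mat n n (\<lambda>(i, j). B $$ (Suc i, Suc j))"
  have C: "C \<in> carrier_mat n n" by (simp add: C_def)
  have "mat_adjoint C = C"
    by (rule eq_matI) (auto simp: C_def Bcnj)
  from Suc.IH[OF C this] obtain V e where dV: "spectral_decomp C V e" by blast
  then have V: "V \<in> carrier_mat n n" and VV: "mat_adjoint V * V = 1\<^sub>m n"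
    and CV: "C = V * mat_diag n (\<lambda>i. complex_of_real (e i)) * mat_adjoint V"
    using C by (auto simp: spectral_decomp_def unitary_mat_def)
  note Va = mat_adjoint_carrier[OF V]
  define ext where "ext a M = four_block_mat (mat 1 1 (\<lambda>_. a)) (0\<^sub>m 1 n) (0\<^sub>m n 1) M"
    for a :: complex and M
  have ext_mult: "ext a M * ext b M' = ext (a * b) (M * M')"
    if "M \<in> carrier_mat n n" "M' \<in> carrier_mat n n" for a b M M'
  proof -
    have 1: "mat (Suc 0) (Suc 0) (\<lambda>_. a) * mat (Suc 0) (Suc 0) (\<lambda>_. b)
        = mat (Suc 0) (Suc 0) (\<lambda>_. a * b)"
      by (rule eq_matI) (auto simp: scalar_prod_def)
    show ?thesis unfolding ext_def using that
      by (subst mult_four_block_mat[of _ 1 1 _ n _ n _ _ 1 _ n]) (auto simp: 1)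
  qed
  have ext_car: "ext a M \<in> carrier_mat ?N ?N" if "M \<in> carrier_mat n n" for a M
    using four_block_carrier_mat[of "mat 1 1 (\<lambda>_. a)" 1 1 M n n] that by (simp add: ext_def)
  have ext_adj: "mat_adjoint (ext 1 V) = ext 1 (mat_adjoint V)"
    by (rule eq_matI) (use V in \<open>auto simp: ext_def\<close>)
  define d where "d i = (case i of 0 \<Rightarrow> Re k | Suc j \<Rightarrow> e j)" for i
  have diag: "mat_diag ?N (\<lambda>i. complex_of_real (d i)) = ext k (mat_diag n (\<lambda>i. complex_of_real (e i)))"
    by (rule eq_matI)
      (use kr in \<open>auto simp: ext_def mat_diag_def d_def split: nat.splits\<close>)
  have Bext: "B = ext k C"
    by (rule eq_matI) (use B in \<open>auto simp: ext_def C_def B0 B0'\<close>)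
  let ?E = "ext 1 V"
  have E: "?E \<in> carrier_mat ?N ?N" using V by (rule ext_car)
  note Ea = mat_adjoint_carrier[OF E]
  let ?D = "mat_diag ?N (\<lambda>i. complex_of_real (d i))"
  have BE: "B = ?E * ?D * mat_adjoint ?E"
    unfolding diag ext_adj Bext CV using V Va by (simp add: ext_mult)
  have uE: "unitary_mat ?N ?E"
  proof (rule unitary_matI[OF E])
    have "ext 1 (1\<^sub>m n) = 1\<^sub>m ?N" by (rule eq_matI) (auto simp: ext_def)
    then show "mat_adjoint ?E * ?E = 1\<^sub>m ?N"
      unfolding ext_adj ext_mult[OF Va V] VV by simp
  qed
  have "A = (W * mat_adjoint W) * A * (W * mat_adjoint W)"
    unfolding WW' using A by simp
  also have "\<dots> = W * B * mat_adjoint W"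
    unfolding B_def using A W Wa by (simp add: assoc_mult_mat[of _ ?N ?N _ ?N _ ?N])
  also have "\<dots> = (W * ?E) * ?D * mat_adjoint (W * ?E)"
    unfolding BE mat_adjoint_mult[OF W E] using W Wa E Ea
    by (simp add: assoc_mult_mat[of _ ?N ?N _ ?N _ ?N] mult_carrier_mat[of _ ?N ?N _ ?N])
  finally have "spectral_decomp A (W * ?E) d"
    using A unitary_mat_mult[OF uW uE] by (auto simp: spectral_decomp_def)
  then show ?case by blast
qed

section \<open>Functional calculus and entropy in terms of eigenvalues\<close>

text \<open>The matrix with eigenvalues \<open>f 0, f 1, \<dots>\<close> on the orthonormal basis of columns of \<open>U\<close>. For fixed
  \<open>U\<close> the lemmas below say that this is an algebra homomorphism in \<open>f\<close> which commutes with the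
  exponential.\<close>

definition unitary_diag :: "nat \<Rightarrow> complex mat \<Rightarrow> (nat \<Rightarrow> complex) \<Rightarrow> complex mat" where
  "unitary_diag n U f = U * mat_diag n f * mat_adjoint U"

lemma unitary_diag_carrier [simp]:
  assumes "unitary_mat n U"
  shows "unitary_diag n U f \<in> carrier_mat n n"
    "dim_row (unitary_diag n U f) = n" "dim_col (unitary_diag n U f) = n"
  using assms by (auto simp: unitary_diag_def unitary_mat_def)

lemma unitary_diag_index:
  assumes "unitary_mat n U" "i < n" "j < n"
  shows "unitary_diag n U f $$ (i, j) = (\<Sum>l<n. U $$ (i, l) * cnj (U $$ (j, l)) * f l)"
proof -
  have U: "U \<in> carrier_mat n n" using assms by (simp add: unitary_mat_def)
  show ?thesis unfolding unitary_diag_def mat_diag_mult_right[OF U] using U assms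
    by (simp add: scalar_prod_def lessThan_atLeast0 mult_ac)
qed

lemma unitary_cols_inner:
  assumes "unitary_mat n U" "l < n" "m < n"
  shows "(\<Sum>i<n. cnj (U $$ (i, l)) * U $$ (i, m)) = (if l = m then 1 else 0)"
proof -
  have U: "U \<in> carrier_mat n n" and UU: "mat_adjoint U * U = 1\<^sub>m n"
    using assms by (auto simp: unitary_mat_def)
  have "(\<Sum>i<n. cnj (U $$ (i, l)) * U $$ (i, m)) = (mat_adjoint U * U) $$ (l, m)"
    using U assms by (simp add: scalar_prod_def lessThan_atLeast0)
  then show ?thesis using assms by (simp add: UU)
qed

lemma unitary_diag_mult:
  assumes "unitary_mat n U"
  shows "unitary_diag n U f * unitary_diag n U g = unitary_diag n U (\<lambda>i. f i * g i)"
proof -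
  have U: "U \<in> carrier_mat n n" and UU: "mat_adjoint U * U = 1\<^sub>m n"
    using assms by (auto simp: unitary_mat_def)
  note Ua = mat_adjoint_carrier[OF U]
  have "unitary_diag n U f * unitary_diag n U g
      = U * (mat_diag n f * ((mat_adjoint U * U) * mat_diag n g)) * mat_adjoint U"
    unfolding unitary_diag_def using U Ua
    by (simp add: assoc_mult_mat[of _ n n _ n _ n] mult_carrier_mat[of _ n n _ n])
  then show ?thesis by (simp add: UU unitary_diag_def left_mult_one_mat[of _ n n])
qed

lemma unitary_diag_const:
  assumes "unitary_mat n U"
  shows "unitary_diag n U (\<lambda>_. a) = a \<cdot>\<^sub>m 1\<^sub>m n"
proof -
  have U: "U \<in> carrier_mat n n" and UU: "U * mat_adjoint U = 1\<^sub>m n"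
    using assms by (auto simp: unitary_mat_def)
  have "U * mat_diag n (\<lambda>_. a) = a \<cdot>\<^sub>m U"
    unfolding mat_diag_mult_right[OF U] by (rule eq_matI) (use U in auto)
  then show ?thesis
    unfolding unitary_diag_def using U mat_adjoint_carrier[OF U] UU
    by (simp add: mult_smult_assoc_mat[of _ n n _ n])
qed

lemma unitary_diag_smult:
  assumes "unitary_mat n U"
  shows "a \<cdot>\<^sub>m unitary_diag n U f = unitary_diag n U (\<lambda>i. a * f i)"
  by (rule eq_matI) (use assms in \<open>auto simp: unitary_diag_index sum_distrib_left mult_ac\<close>)

lemma unitary_diag_add:
  assumes "unitary_mat n U"
  shows "unitary_diag n U f + unitary_diag n U g = unitary_diag n U (\<lambda>i. f i + g i)"
  by (rule eq_matI) (use assms in \<open>auto simp: unitary_diag_index sum.distrib algebra_simps\<close>)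

lemma unitary_diag_pow:
  assumes "unitary_mat n U"
  shows "unitary_diag n U f ^\<^sub>m k = unitary_diag n U (\<lambda>i. f i ^ k)"
proof (induction k)
  case 0
  have "1 \<cdot>\<^sub>m 1\<^sub>m n = (1\<^sub>m n :: complex mat)" by auto
  then show ?case using unitary_diag_const[OF assms, of 1] assms by simp
next
  case (Suc k)
  then show ?case using assms by (simp add: unitary_diag_mult mult.commute)
qed

lemma mat_trace_unitary_diag:
  assumes "unitary_mat n U"
  shows "mat_trace (unitary_diag n U f) = (\<Sum>l<n. f l)"
proof -
  have "mat_trace (unitary_diag n U f) = (\<Sum>i<n. \<Sum>l<n. U $$ (i, l) * cnj (U $$ (i, l)) * f l)"
    using assms by (simp add: mat_trace_def unitary_diag_index)
  also have "\<dots> = (\<Sum>l<n. (\<Sum>i<n. cnj (U $$ (i, l)) * U $$ (i, l)) * f l)"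
    by (subst sum.swap) (simp add: sum_distrib_left mult_ac)
  also have "\<dots> = (\<Sum>l<n. f l)" using assms by (simp add: unitary_cols_inner)
  finally show ?thesis .
qed

lemma mat_exp_unitary_diag:
  assumes "unitary_mat n U"
  shows "mat_exp (unitary_diag n U f) = unitary_diag n U (\<lambda>i. exp (f i))"
proof (rule eq_matI)
  fix i j assume "i < dim_row (unitary_diag n U (\<lambda>i. exp (f i)))"
    and "j < dim_col (unitary_diag n U (\<lambda>i. exp (f i)))"
  then have ij: "i < n" "j < n" using assms by auto
  have e: "(\<lambda>k. f l ^ k / fact k) sums exp (f l)" for l
    using exp_converges[of "f l"] by (simp add: scaleR_conv_of_real divide_inverse mult.commute)
  have "(\<lambda>k. \<Sum>l<n. U $$ (i, l) * cnj (U $$ (j, l)) * (f l ^ k / fact k)) sums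
      (\<Sum>l<n. U $$ (i, l) * cnj (U $$ (j, l)) * exp (f l))"
    by (intro sums_sum sums_mult e)
  then have "(\<lambda>k. (unitary_diag n U f ^\<^sub>m k) $$ (i, j) / fact k) sums
      unitary_diag n U (\<lambda>i. exp (f i)) $$ (i, j)"
    using ij by (simp add: unitary_diag_pow[OF assms] unitary_diag_index[OF assms] sum_divide_distrib)
  then show "mat_exp (unitary_diag n U f) $$ (i, j) = unitary_diag n U (\<lambda>i. exp (f i)) $$ (i, j)"
    using ij assms by (simp add: mat_exp_def sums_iff)
qed (use assms in \<open>simp_all add: mat_exp_def\<close>)

lemma spectral_decomp_iff_unitary_diag:
  assumes "A \<in> carrier_mat n n"
  shows "spectral_decomp A U d \<longleftrightarrow> unitary_mat n U \<and> A = unitary_diag n U (\<lambda>i. complex_of_real (d i))"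
  using assms by (simp add: spectral_decomp_def unitary_diag_def)

text \<open>This is \<open>- \<Sum>i. p i ln (p i)\<close> for the Boltzmann weights \<open>p i = exp (- \<tau> d i) / Z\<close>, written as
  logarithm of the partition function plus \<open>\<tau>\<close> times the mean energy. Negative \<open>\<tau>\<close> are allowed, so
  that the energies \<open>- a i\<close> of an adjacency matrix can be expressed through its eigenvalues \<open>a i\<close>.\<close>

definition spectral_entropy :: "nat \<Rightarrow> real \<Rightarrow> (nat \<Rightarrow> real) \<Rightarrow> real" where
  "spectral_entropy n \<tau> d = ln (\<Sum>i<n. exp (- \<tau> * d i)) +
     \<tau> * (\<Sum>i<n. d i * exp (- \<tau> * d i)) / (\<Sum>i<n. exp (- \<tau> * d i))"

lemma von_neumann_entropy_gibbs_state:
  assumes H: "H \<in> carrier_mat n n" and n: "n > 0" and dec: "spectral_decomp H U d"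
  shows "von_neumann_entropy (gibbs_state \<tau> H) = spectral_entropy n \<tau> d"
proof -
  have U: "unitary_mat n U" and HU: "H = unitary_diag n U (\<lambda>i. complex_of_real (d i))"
    using dec spectral_decomp_iff_unitary_diag[OF H] by auto
  define Z where "Z = (\<Sum>i<n. exp (- \<tau> * d i))"
  define p where "p i = exp (- \<tau> * d i) / Z" for i
  have Z: "Z > 0" unfolding Z_def using n by (intro sum_pos) auto
  have ex: "mat_exp (complex_of_real (- \<tau>) \<cdot>\<^sub>m H)
      = unitary_diag n U (\<lambda>i. complex_of_real (exp (- \<tau> * d i)))"
    unfolding HU unitary_diag_smult[OF U] mat_exp_unitary_diag[OF U]
    by (simp flip: exp_of_real)
  have tr: "mat_trace (mat_exp (complex_of_real (- \<tau>) \<cdot>\<^sub>m H)) = complex_of_real Z"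
    unfolding ex mat_trace_unitary_diag[OF U] by (simp add: Z_def)
  have g: "gibbs_state \<tau> H = unitary_diag n U (\<lambda>i. complex_of_real (p i))"
    unfolding gibbs_state_def tr unfolding ex unitary_diag_smult[OF U]
    by (simp add: p_def)
  have gc: "gibbs_state \<tau> H \<in> carrier_mat n n" unfolding g using U by simp
  have "spectral_decomp (gibbs_state \<tau> H) U p"
    unfolding spectral_decomp_iff_unitary_diag[OF gc] using U g by simp
  from hermitian_fun_eq[OF this, of ln]
  have "hermitian_fun ln (gibbs_state \<tau> H) = unitary_diag n U (\<lambda>i. complex_of_real (ln (p i)))"
    using gc by (simp add: unitary_diag_def)
  then have "von_neumann_entropy (gibbs_state \<tau> H)
      = Re (- mat_trace (unitary_diag n U (\<lambda>i. complex_of_real (p i * ln (p i)))))"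
    by (simp add: von_neumann_entropy_def g unitary_diag_mult[OF U])
  also have "\<dots> = - (\<Sum>i<n. p i * ln (p i))"
    by (simp add: mat_trace_unitary_diag[OF U])
  also have "\<dots> = (\<Sum>i<n. p i * ln Z + \<tau> * (d i * exp (- \<tau> * d i)) / Z)"
    unfolding sum_negf[symmetric] using Z
    by (intro sum.cong refl) (simp add: p_def ln_div field_simps)
  also have "\<dots> = ln Z * (\<Sum>i<n. p i) + \<tau> * (\<Sum>i<n. d i * exp (- \<tau> * d i)) / Z"
    by (simp add: sum.distrib sum_distrib_left sum_divide_distrib mult.commute)
  also have "(\<Sum>i<n. p i) = 1"
    unfolding p_def sum_divide_distrib[symmetric] using Z by (simp add: Z_def)
  finally show ?thesis by (simp add: spectral_entropy_def Z_def)
qed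

lemma spectral_decomp_affine:
  assumes A: "A \<in> carrier_mat n n" and dec: "spectral_decomp A U d"
    and B: "B = complex_of_real c \<cdot>\<^sub>m 1\<^sub>m n + complex_of_real a \<cdot>\<^sub>m A"
  shows "spectral_decomp B U (\<lambda>i. c + a * d i)"
proof -
  have U: "unitary_mat n U" and AU: "A = unitary_diag n U (\<lambda>i. complex_of_real (d i))"
    using dec spectral_decomp_iff_unitary_diag[OF A] by auto
  have Bc: "B \<in> carrier_mat n n" unfolding B using A by simp
  have "B = unitary_diag n U (\<lambda>i. complex_of_real (c + a * d i))"
    unfolding B AU unitary_diag_smult[OF U] unitary_diag_const[OF U, symmetric] unitary_diag_add[OF U]
    by simp
  then show ?thesis using U unfolding spectral_decomp_iff_unitary_diag[OF Bc] by blast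
qed

text \<open>Adding \<open>c\<close> to all energies multiplies every Boltzmann weight by the same factor, which cancels in
  the state.\<close>

lemma spectral_entropy_affine:
  assumes "n > 0"
  shows "spectral_entropy n \<tau> (\<lambda>i. c + a * d i) = spectral_entropy n (\<tau> * a) d"
proof -
  define Z where "Z = (\<Sum>i<n. exp (- (\<tau> * a) * d i))"
  define M where "M = (\<Sum>i<n. d i * exp (- (\<tau> * a) * d i))"
  have Z: "Z > 0" unfolding Z_def using assms by (intro sum_pos) auto
  have e: "exp (- \<tau> * (c + a * d i)) = exp (- \<tau> * c) * exp (- (\<tau> * a) * d i)" for i
    by (simp add: algebra_simps flip: exp_add)
  have 1: "(\<Sum>i<n. exp (- \<tau> * (c + a * d i))) = exp (- \<tau> * c) * Z"
    by (simp only: e Z_def sum_distrib_left)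
  have 2: "(\<Sum>i<n. (c + a * d i) * exp (- \<tau> * (c + a * d i))) = exp (- \<tau> * c) * (c * Z + a * M)"
    unfolding e Z_def M_def sum_distrib_left sum.distrib[symmetric]
    by (intro sum.cong refl) (simp add: algebra_simps)
  show ?thesis
    unfolding spectral_entropy_def 1 2 Z_def[symmetric] M_def[symmetric] using Z
    by (simp add: ln_mult field_simps)
qed

lemma sum_eigenvalues:
  assumes A: "A \<in> carrier_mat n n" and dec: "spectral_decomp A U d"
  shows "(\<Sum>i<n. complex_of_real (d i)) = (\<Sum>i<n. A $$ (i, i))"
  using mat_trace_unitary_diag[of n U] dec A
  by (metis carrier_matD(1) mat_trace_def spectral_decomp_iff_unitary_diag)

lemma sum_eigenvalues_squared:
  assumes A: "A \<in> carrier_mat n n" and dec: "spectral_decomp A U d"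
  shows "(\<Sum>i<n. complex_of_real ((d i)\<^sup>2)) = (\<Sum>i<n. \<Sum>j<n. A $$ (i, j) * A $$ (j, i))"
proof -
  have U: "unitary_mat n U" and AU: "A = unitary_diag n U (\<lambda>i. complex_of_real (d i))"
    using dec spectral_decomp_iff_unitary_diag[OF A] by auto
  have "mat_trace (A * A) = (\<Sum>i<n. complex_of_real ((d i)\<^sup>2))"
    unfolding AU unitary_diag_mult[OF U] mat_trace_unitary_diag[OF U]
    by (simp add: power2_eq_square)
  then show ?thesis using A by (simp add: mat_trace_def scalar_prod_def lessThan_atLeast0)
qed

text \<open>If \<open>k\<close> were not among the \<open>d l\<close>, then all coordinates of \<open>v\<close> in the eigenbasis would vanish,
  because the coordinate for \<open>d l\<close> is multiplied both by \<open>d l\<close> and by \<open>k\<close>.\<close>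

lemma eigenvector_imp_eigenvalue_listed:
  assumes A: "A \<in> carrier_mat n n" and dec: "spectral_decomp A U d"
    and ev: "\<And>i. i < n \<Longrightarrow> (\<Sum>j<n. A $$ (i, j) * v j) = complex_of_real k * v i"
    and v0: "i0 < n" "v i0 \<noteq> 0"
  shows "\<exists>l<n. d l = k"
proof (rule ccontr)
  assume no: "\<not> ?thesis"
  have U: "unitary_mat n U" and AU: "A = unitary_diag n U (\<lambda>i. complex_of_real (d i))"
    using dec spectral_decomp_iff_unitary_diag[OF A] by auto
  \<comment> \<open>coordinates of \<open>v\<close> in the eigenbasis\<close>
  define w where "w l = (\<Sum>j<n. cnj (U $$ (j, l)) * v j)" for l
  have Av: "(\<Sum>j<n. A $$ (i, j) * v j) = (\<Sum>l<n. U $$ (i, l) * (complex_of_real (d l) * w l))" if "i < n" for i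
  proof -
    have "(\<Sum>j<n. A $$ (i, j) * v j)
        = (\<Sum>j<n. \<Sum>l<n. U $$ (i, l) * (complex_of_real (d l) * (cnj (U $$ (j, l)) * v j)))"
      unfolding AU using that
      by (simp add: unitary_diag_index[OF U] sum_distrib_left sum_distrib_right mult_ac)
    then show ?thesis by (subst (asm) sum.swap) (simp add: w_def sum_distrib_left)
  qed
  have w0: "w m = 0" if m: "m < n" for m
  proof -
    have "complex_of_real k * w m = (\<Sum>i<n. cnj (U $$ (i, m)) * (complex_of_real k * v i))"
      by (simp add: w_def sum_distrib_left mult_ac)
    also have "\<dots> = (\<Sum>i<n. cnj (U $$ (i, m)) * (\<Sum>l<n. U $$ (i, l) * (complex_of_real (d l) * w l)))"
      by (intro sum.cong refl) (simp add: ev[symmetric] Av)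
    also have "\<dots> = (\<Sum>l<n. \<Sum>i<n. cnj (U $$ (i, m)) * (U $$ (i, l) * (complex_of_real (d l) * w l)))"
      unfolding sum_distrib_left by (rule sum.swap)
    also have "\<dots> = (\<Sum>l<n. (\<Sum>i<n. cnj (U $$ (i, m)) * U $$ (i, l)) * (complex_of_real (d l) * w l))"
      by (simp only: sum_distrib_right mult.assoc)
    also have "\<dots> = (\<Sum>l<n. if l = m then complex_of_real (d l) * w l else 0)"
      using m by (intro sum.cong refl) (auto simp: unitary_cols_inner[OF U])
    also have "\<dots> = complex_of_real (d m) * w m" using m by simp
    finally show ?thesis using no m by auto
  qed
  \<comment> \<open>reconstruct \<open>v\<close> from its coordinates, using that \<open>U\<close> times its adjoint is the identity\<close>
  have "v i0 = (\<Sum>j<n. (if i0 = j then 1 else 0) * v j)"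
    using v0(1) by (simp add: if_distrib[of "\<lambda>x. x * _"] cong: if_cong)
  also have "\<dots> = (\<Sum>j<n. unitary_diag n U (\<lambda>_. 1) $$ (i0, j) * v j)"
    using v0(1) by (intro sum.cong refl) (simp add: unitary_diag_const[OF U])
  also have "\<dots> = (\<Sum>j<n. \<Sum>l<n. U $$ (i0, l) * (cnj (U $$ (j, l)) * v j))"
    using v0(1) by (simp add: unitary_diag_index[OF U] sum_distrib_left sum_distrib_right mult_ac)
  also have "\<dots> = (\<Sum>l<n. U $$ (i0, l) * w l)"
    by (subst sum.swap) (simp add: w_def sum_distrib_left)
  also have "\<dots> = 0" using w0 by simp
  finally show False using v0 by simp
qed

section \<open>Spectra of real symmetric matrices\<close>

definition of_real_mat :: "nat \<Rightarrow> (nat \<Rightarrow> nat \<Rightarrow> real) \<Rightarrow> complex mat" where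
  "of_real_mat n a = mat n n (\<lambda>(i, j). complex_of_real (a i j))"

lemma of_real_mat_carrier [simp]: "of_real_mat n a \<in> carrier_mat n n"
  by (simp add: of_real_mat_def)

lemma of_real_mat_dim [simp]: "dim_row (of_real_mat n a) = n" "dim_col (of_real_mat n a) = n"
  by (simp_all add: of_real_mat_def)

lemma of_real_mat_index [simp]:
  "i < n \<Longrightarrow> j < n \<Longrightarrow> of_real_mat n a $$ (i, j) = complex_of_real (a i j)"
  by (simp add: of_real_mat_def)

lemma spectral_decomp_of_real_mat_exists:
  assumes "\<And>i j. i < n \<Longrightarrow> j < n \<Longrightarrow> a i j = a j i"
  shows "\<exists>U d. spectral_decomp (of_real_mat n a) U d"
proof (rule spectral_decomp_exists[of _ n])
  show "mat_adjoint (of_real_mat n a) = of_real_mat n a"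
    by (rule eq_matI) (auto simp: of_real_mat_def assms)
qed simp

lemma sum_eigenvalues_of_real_mat:
  assumes "spectral_decomp (of_real_mat n a) U d"
  shows "(\<Sum>i<n. d i) = (\<Sum>i<n. a i i)"
proof -
  have "complex_of_real (\<Sum>i<n. d i) = complex_of_real (\<Sum>i<n. a i i)"
    using sum_eigenvalues[OF _ assms] by simp
  then show ?thesis by (simp only: of_real_eq_iff)
qed

text \<open>Both sides are the trace of the square of the matrix minus \<open>c\<close> times the identity.\<close>

lemma sum_eigenvalues_centered_squared:
  assumes dec: "spectral_decomp (of_real_mat n a) U d"
    and sym: "\<And>i j. i < n \<Longrightarrow> j < n \<Longrightarrow> a i j = a j i"
  shows "(\<Sum>i<n. (d i - c)\<^sup>2) = (\<Sum>i<n. \<Sum>j<n. (a i j - (if i = j then c else 0))\<^sup>2)"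
proof -
  define b where "b i j = a i j - (if i = j then c else 0)" for i j
  have B: "of_real_mat n b
      = complex_of_real (- c) \<cdot>\<^sub>m 1\<^sub>m n + complex_of_real 1 \<cdot>\<^sub>m of_real_mat n a"
    by (rule eq_matI) (auto simp: of_real_mat_def b_def)
  have "spectral_decomp (of_real_mat n b) U (\<lambda>i. - c + 1 * d i)"
    by (rule spectral_decomp_affine[OF _ dec B]) simp
  from sum_eigenvalues_squared[OF _ this]
  have "(\<Sum>i<n. complex_of_real ((d i - c)\<^sup>2)) = (\<Sum>i<n. \<Sum>j<n. complex_of_real (b i j * b j i))"
    by simp
  also have "\<dots> = (\<Sum>i<n. \<Sum>j<n. complex_of_real ((b i j)\<^sup>2))"
    by (intro sum.cong refl) (auto simp: b_def sym power2_eq_square)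
  finally have "complex_of_real (\<Sum>i<n. (d i - c)\<^sup>2) = complex_of_real (\<Sum>i<n. \<Sum>j<n. (b i j)\<^sup>2)"
    by simp
  then show ?thesis by (simp only: of_real_eq_iff b_def)
qed

text \<open>Compare both sides of the eigenvalue equation at an index where the eigenvector has an entry of
  maximal modulus.\<close>

lemma abs_eigenvalue_le_row_sum:
  assumes dec: "spectral_decomp (of_real_mat n a) U d" and l: "l < n"
    and row: "\<And>i. i < n \<Longrightarrow> (\<Sum>j<n. \<bar>a i j\<bar>) \<le> r"
  shows "\<bar>d l\<bar> \<le> r"
proof -
  have U: "unitary_mat n U"
    and AU: "of_real_mat n a = unitary_diag n U (\<lambda>i. complex_of_real (d i))"
    using dec spectral_decomp_iff_unitary_diag[of "of_real_mat n a" n] by auto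
  have ev: "(\<Sum>j<n. complex_of_real (a i j) * U $$ (j, l)) = complex_of_real (d l) * U $$ (i, l)"
    if i: "i < n" for i
  proof -
    have "(\<Sum>j<n. complex_of_real (a i j) * U $$ (j, l))
        = (\<Sum>j<n. unitary_diag n U (\<lambda>i. complex_of_real (d i)) $$ (i, j) * U $$ (j, l))"
      using i by (simp flip: AU)
    also have "\<dots> = (\<Sum>j<n. \<Sum>m<n. (U $$ (i, m) * complex_of_real (d m)) * (cnj (U $$ (j, m)) * U $$ (j, l)))"
      using i by (simp add: unitary_diag_index[OF U] sum_distrib_left sum_distrib_right mult_ac)
    also have "\<dots> = (\<Sum>m<n. (U $$ (i, m) * complex_of_real (d m)) * (\<Sum>j<n. cnj (U $$ (j, m)) * U $$ (j, l)))"
      unfolding sum_distrib_left by (rule sum.swap)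
    also have "\<dots> = (\<Sum>m<n. if m = l then U $$ (i, m) * complex_of_real (d m) else 0)"
      using l by (intro sum.cong refl) (auto simp: unitary_cols_inner[OF U])
    also have "\<dots> = complex_of_real (d l) * U $$ (i, l)" using l by simp
    finally show ?thesis .
  qed
  let ?u = "\<lambda>i. cmod (U $$ (i, l))"
  have ne: "?u ` {..<n} \<noteq> {}" using l by auto
  obtain i where i: "i < n" and max: "\<And>j. j < n \<Longrightarrow> ?u j \<le> ?u i"
    using Max_in[OF _ ne] Max_ge[of "?u ` {..<n}"] by fastforce
  have "?u i \<noteq> 0"
  proof
    assume "?u i = 0"
    then have "U $$ (j, l) = 0" if "j < n" for j using max[OF that] by simp
    then show False using unitary_cols_inner[OF U l l] by simp
  qed
  moreover have "\<bar>d l\<bar> * ?u i \<le> r * ?u i"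
  proof -
    have "\<bar>d l\<bar> * ?u i = cmod (\<Sum>j<n. complex_of_real (a i j) * U $$ (j, l))"
      unfolding ev[OF i] by (simp add: norm_mult)
    also have "\<dots> \<le> (\<Sum>j<n. \<bar>a i j\<bar> * ?u j)"
      by (rule order_trans[OF norm_sum]) (simp add: norm_mult)
    also have "\<dots> \<le> (\<Sum>j<n. \<bar>a i j\<bar> * ?u i)"
      by (intro sum_mono mult_left_mono max) auto
    also have "\<dots> \<le> r * ?u i"
      unfolding sum_distrib_right[symmetric] by (intro mult_right_mono row i) auto
    finally show ?thesis .
  qed
  ultimately show ?thesis by simp
qed

text \<open>The squares of \<open>d i - c\<close> at indices outside those that realise \<open>\<Lambda>\<close> add up to \<open>0\<close>, so \<open>d i = c\<close>
  there.\<close>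

lemma sum_over_few_levels:
  fixes d :: "nat \<Rightarrow> real" and g :: "real \<Rightarrow> real"
  assumes fin: "finite \<Lambda>" and ev: "\<And>\<mu>. \<mu> \<in> \<Lambda> \<Longrightarrow> \<exists>l<n. d l = \<mu>"
    and sq: "(\<Sum>i<n. (d i - c)\<^sup>2) = (\<Sum>\<mu>\<in>\<Lambda>. (\<mu> - c)\<^sup>2)"
  shows "(\<Sum>i<n. g (d i)) = (\<Sum>\<mu>\<in>\<Lambda>. g \<mu>) + (real n - real (card \<Lambda>)) * g c"
proof -
  obtain l where l: "\<And>\<mu>. \<mu> \<in> \<Lambda> \<Longrightarrow> l \<mu> < n \<and> d (l \<mu>) = \<mu>" using ev by metis
  have inj: "inj_on l \<Lambda>" by (rule inj_onI) (metis l)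
  define I where "I = l ` \<Lambda>"
  have I: "I \<subseteq> {..<n}" and cI: "card I = card \<Lambda>"
    using l by (auto simp: I_def card_image[OF inj])
  have onI: "(\<Sum>i\<in>I. f (d i)) = (\<Sum>\<mu>\<in>\<Lambda>. f \<mu>)" for f :: "real \<Rightarrow> real"
    unfolding I_def sum.reindex[OF inj] using l by (intro sum.cong) auto
  have split: "(\<Sum>i<n. f (d i)) = (\<Sum>\<mu>\<in>\<Lambda>. f \<mu>) + (\<Sum>i\<in>{..<n} - I. f (d i))" for f :: "real \<Rightarrow> real"
    unfolding onI[symmetric] using sum.subset_diff[OF I, of "\<lambda>i. f (d i)"] by simp
  have "(\<Sum>i\<in>{..<n} - I. (d i - c)\<^sup>2) = 0"
    using split[of "\<lambda>x. (x - c)\<^sup>2"] sq by simp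
  then have "d i = c" if "i \<in> {..<n} - I" for i
    using that by (subst (asm) sum_nonneg_eq_0_iff) auto
  then have "(\<Sum>i\<in>{..<n} - I. g (d i)) = real (card ({..<n} - I)) * g c" by simp
  also have "card ({..<n} - I) = n - card \<Lambda>"
    using I cI by (simp add: card_Diff_subset finite_subset)
  also have "real (n - card \<Lambda>) = real n - real (card \<Lambda>)"
    using card_mono[OF _ I] cI by simp
  finally show ?thesis using split[of g] by simp
qed

text \<open>Exhibiting eigenvectors for the exceptional eigenvalues \<open>\<Lambda>\<close> only shows that each of them occurs.
  The second moment about \<open>c\<close> shows that they are simple and that \<open>c\<close> is the only other
  eigenvalue, without an eigenbasis for \<open>c\<close>.\<close>

lemma spectral_decomp_few_levels:
  assumes sym: "\<And>i j. i < n \<Longrightarrow> j < n \<Longrightarrow> a i j = a j i" and fin: "finite \<Lambda>"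
    and ev: "\<And>\<mu>. \<mu> \<in> \<Lambda> \<Longrightarrow>
      \<exists>v. (\<exists>i<n. v i \<noteq> 0) \<and> (\<forall>i<n. (\<Sum>j<n. a i j * v j) = \<mu> * v i)"
    and sq: "(\<Sum>i<n. \<Sum>j<n. (a i j - (if i = j then c else 0))\<^sup>2) = (\<Sum>\<mu>\<in>\<Lambda>. (\<mu> - c)\<^sup>2)"
  shows "\<exists>U d. spectral_decomp (of_real_mat n a) U d \<and>
    (\<forall>g. (\<Sum>i<n. g (d i)) = (\<Sum>\<mu>\<in>\<Lambda>. g \<mu>) + (real n - real (card \<Lambda>)) * (g c :: real))"
proof -
  obtain U d where dec: "spectral_decomp (of_real_mat n a) U d"
    using spectral_decomp_of_real_mat_exists[of n a, OF sym] by blast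
  have listed: "\<exists>l<n. d l = \<mu>" if "\<mu> \<in> \<Lambda>" for \<mu>
  proof -
    from ev[OF that] obtain v i0 where v: "i0 < n" "v i0 \<noteq> 0"
      and av: "\<And>i. i < n \<Longrightarrow> (\<Sum>j<n. a i j * v j) = \<mu> * v i" by blast
    show ?thesis
    proof (rule eigenvector_imp_eigenvalue_listed[OF _ dec, where v = "\<lambda>i. complex_of_real (v i)"])
      show "(\<Sum>j<n. of_real_mat n a $$ (i, j) * complex_of_real (v j))
          = complex_of_real \<mu> * complex_of_real (v i)" if "i < n" for i
        using arg_cong[OF av[OF that], of complex_of_real] that by simp
    qed (use v in auto)
  qed
  have "(\<Sum>i<n. (d i - c)\<^sup>2) = (\<Sum>\<mu>\<in>\<Lambda>. (\<mu> - c)\<^sup>2)"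
    using sum_eigenvalues_centered_squared[OF dec sym] sq by simp
  from sum_over_few_levels[OF fin listed this] dec show ?thesis by blast
qed

section \<open>Entropies in terms of the adjacency spectrum\<close>

definition adj :: "ugraph \<Rightarrow> nat \<Rightarrow> nat \<Rightarrow> real" where
  "adj G i j = of_bool ({i, j} \<in> edges G)"

lemma adj_sym: "adj G i j = adj G j i"
  by (simp add: adj_def insert_commute)

lemma adj_squared [simp]: "(adj G i j)\<^sup>2 = adj G i j"
  by (simp add: adj_def)

lemma adj_diag [simp]: "simple_graph G \<Longrightarrow> adj G i i = 0"
  by (auto simp: adj_def simple_graph_def)

lemma adjacency_matrix_eq: "adjacency_matrix G = of_real_mat (order_of G) (adj G)"
  by (rule eq_matI) (auto simp: adjacency_matrix_def of_real_mat_def adj_def)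

lemma sum_adj_row: "(\<Sum>j<order_of G. adj G i j) = real (degree_of G i)"
proof -
  have "{..<order_of G} \<inter> {j. {i, j} \<in> edges G} = {j. j < order_of G \<and> {i, j} \<in> edges G}" by auto
  then show ?thesis by (simp add: adj_def degree_of_def sum.If_cases of_bool_def)
qed

lemma laplacian_eq:
  "laplacian G = of_real_mat (order_of G)
    (\<lambda>i j. (if i = j then real (degree_of G i) else 0) - adj G i j)"
  by (rule eq_matI)
    (auto simp: laplacian_def degree_matrix_def adjacency_matrix_eq of_real_mat_def mat_diag_def)

lemma entropy_adj_eq:
  assumes n: "order_of G > 0" and dec: "spectral_decomp (adjacency_matrix G) U a"
  shows "entropy_adj \<tau> G = spectral_entropy (order_of G) (- \<tau>) a"
proof -
  have A: "adjacency_matrix G \<in> carrier_mat (order_of G) (order_of G)"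
    by (simp add: adjacency_matrix_eq)
  have "- adjacency_matrix G
      = complex_of_real 0 \<cdot>\<^sub>m 1\<^sub>m (order_of G) + complex_of_real (- 1) \<cdot>\<^sub>m adjacency_matrix G"
    by (rule eq_matI) (use A in auto)
  from spectral_decomp_affine[OF A dec this] spectral_entropy_affine[OF n, of \<tau> 0 "- 1" a] A n
  show ?thesis
    by (simp add: entropy_adj_def von_neumann_entropy_gibbs_state[OF _ n])
qed

text \<open>The shift \<open>c\<close> leaves the state unchanged and the factor \<open>s\<close> is absorbed into \<open>\<tau>\<close>; the sign is
  the one of the convention \<open>H = - A\<close>. Both Laplacian reductions below are instances.\<close>

lemma entropy_affine_adjacency:
  assumes n: "order_of G > 0"
    and H: "H = complex_of_real c \<cdot>\<^sub>m 1\<^sub>m (order_of G) + complex_of_real (- s) \<cdot>\<^sub>m adjacency_matrix G"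
  shows "von_neumann_entropy (gibbs_state \<tau> H) = entropy_adj (\<tau> * s) G"
proof -
  have A: "adjacency_matrix G \<in> carrier_mat (order_of G) (order_of G)"
    by (simp add: adjacency_matrix_eq)
  then have Hc: "H \<in> carrier_mat (order_of G) (order_of G)" by (simp add: H)
  obtain U a where dec: "spectral_decomp (adjacency_matrix G) U a"
    unfolding adjacency_matrix_eq
    using spectral_decomp_of_real_mat_exists[of "order_of G" "adj G", OF adj_sym] by blast
  show ?thesis
    unfolding von_neumann_entropy_gibbs_state[OF Hc n spectral_decomp_affine[OF A dec H]]
      entropy_adj_eq[OF n dec]
    using spectral_entropy_affine[OF n, of \<tau> c "- s" a] by simp
qed

lemma entropy_lap_regular:
  assumes n: "order_of G > 0" and reg: "\<And>i. i < order_of G \<Longrightarrow> degree_of G i = k"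
  shows "entropy_lap \<tau> G = entropy_adj \<tau> G"
proof -
  have "laplacian G = complex_of_real (real k) \<cdot>\<^sub>m 1\<^sub>m (order_of G)
      + complex_of_real (- 1) \<cdot>\<^sub>m adjacency_matrix G"
    by (rule eq_matI) (auto simp: laplacian_eq adjacency_matrix_eq of_real_mat_def reg)
  from entropy_affine_adjacency[OF n this] show ?thesis by (simp add: entropy_lap_def)
qed

text \<open>The entry of the normalized Laplacian at an edge \<open>{i, j}\<close> is \<open>- 1 / sqrt (deg i * deg j)\<close>, here
  \<open>- 1 / q\<close>, so this matrix is \<open>I - A / q\<close>.\<close>

lemma entropy_nlap_const_degree_product:
  assumes n: "order_of G > 0" and simple: "simple_graph G" and q: "q > 0"
    and pos: "\<And>i. i < order_of G \<Longrightarrow> degree_of G i > 0"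
    and prod: "\<And>i j. i < order_of G \<Longrightarrow> j < order_of G \<Longrightarrow> {i, j} \<in> edges G \<Longrightarrow>
      real (degree_of G i) * real (degree_of G j) = q\<^sup>2"
  shows "entropy_nlap \<tau> G = entropy_adj (\<tau> / q) G"
proof -
  let ?n = "order_of G"
  have L: "laplacian G \<in> carrier_mat ?n ?n" by (simp add: laplacian_eq)
  let ?r = "\<lambda>i. complex_of_real (1 / sqrt (real (degree_of G i)))"
  have entry: "normalized_laplacian G $$ (i, j) = ?r i * laplacian G $$ (i, j) * ?r j"
    if "i < ?n" "j < ?n" for i j
    using that L unfolding normalized_laplacian_def degree_matrix_inv_sqrt_def
    by (simp add: mat_diag_mult_left[OF L] mat_diag_mult_right[of _ ?n ?n])
  have "normalized_laplacian G = complex_of_real 1 \<cdot>\<^sub>m 1\<^sub>m ?n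
      + complex_of_real (- (1 / q)) \<cdot>\<^sub>m adjacency_matrix G" (is "_ = ?R")
  proof (rule eq_matI)
    fix i j assume "i < dim_row ?R" "j < dim_col ?R"
    then have ij: "i < ?n" "j < ?n" by (auto simp: adjacency_matrix_eq of_real_mat_def)
    let ?x = "(if i = j then real (degree_of G i) else 0) - adj G i j"
    have scaled: "1 / sqrt (real (degree_of G i)) * ?x * (1 / sqrt (real (degree_of G j)))
        = (if i = j then 1 else 0) - 1 / q * adj G i j"
    proof (cases "{i, j} \<in> edges G")
      case True
      then have "i \<noteq> j" using simple by (auto simp: simple_graph_def)
      moreover have "sqrt (real (degree_of G i)) * sqrt (real (degree_of G j)) = q"
        using prod[OF ij True] q by (simp flip: real_sqrt_mult)
      ultimately show ?thesis using True by (simp add: adj_def)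
    next
      case False
      then show ?thesis using pos[OF ij(1)] by (auto simp: adj_def)
    qed
    have lap: "laplacian G $$ (i, j) = complex_of_real ?x"
      using ij by (simp add: laplacian_eq)
    have "?R $$ (i, j) = complex_of_real ((if i = j then 1 else 0) - 1 / q * adj G i j)"
      using ij by (simp add: adjacency_matrix_eq)
    then show "normalized_laplacian G $$ (i, j) = ?R $$ (i, j)"
      unfolding entry[OF ij] lap scaled[symmetric] by simp
  qed (simp_all add: normalized_laplacian_def degree_matrix_inv_sqrt_def adjacency_matrix_eq
      of_real_mat_def mat_diag_def)
  from entropy_affine_adjacency[OF n this] show ?thesis by (simp add: entropy_nlap_def)
qed

section \<open>Empty and complete graphs\<close>

lemma entropy_empty_graph:
  assumes "n > 0"
  shows "entropy_adj \<tau> (empty_graph n) = ln (real n)" "entropy_lap \<tau> (empty_graph n) = ln (real n)"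
proof -
  let ?G = "empty_graph n"
  have n: "order_of ?G > 0" using assms by (simp add: empty_graph_def)
  have A: "adjacency_matrix ?G = 0\<^sub>m n n"
    by (rule eq_matI) (simp_all add: adjacency_matrix_def empty_graph_def)
  have "mat_adjoint (1\<^sub>m n) = (1\<^sub>m n :: complex mat)" by (rule eq_matI) auto
  then have "spectral_decomp (adjacency_matrix ?G) (1\<^sub>m n) (\<lambda>_. 0)"
    unfolding A by (auto simp: spectral_decomp_def unitary_mat_def mat_diag_def)
  from entropy_adj_eq[OF n this] show e: "entropy_adj \<tau> ?G = ln (real n)"
    by (simp add: spectral_entropy_def empty_graph_def)
  have "entropy_lap \<tau> ?G = entropy_adj \<tau> ?G"
    by (rule entropy_lap_regular[OF n, of 0]) (simp add: degree_of_def empty_graph_def)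
  then show "entropy_lap \<tau> ?G = ln (real n)" using e by simp
qed

lemma order_complete_graph [simp]: "order_of (complete_graph n) = n"
  by (simp add: complete_graph_def)

lemma adj_complete_graph: "i < n \<Longrightarrow> j < n \<Longrightarrow> adj (complete_graph n) i j = of_bool (i \<noteq> j)"
  by (auto simp: adj_def complete_graph_def doubleton_eq_iff)

lemma degree_complete_graph: "i < n \<Longrightarrow> degree_of (complete_graph n) i = n - 1"
proof -
  assume i: "i < n"
  have "{j. j < order_of (complete_graph n) \<and> {i, j} \<in> edges (complete_graph n)} = {..<n} - {i}"
    using i by (auto simp: complete_graph_def doubleton_eq_iff)
  then show ?thesis using i by (simp add: degree_of_def)
qed

text \<open>\<open>A + I\<close> is the all-ones matrix: the vector of ones has eigenvalue \<open>n - 1\<close>, all other eigenvalues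
  are \<open>- 1\<close>.\<close>

lemma entropy_adj_complete_graph:
  assumes n: "n \<ge> 2"
  shows "entropy_adj \<tau> (complete_graph n) =
    ln (exp (\<tau> * (real n - 1)) + (real n - 1) * exp (- \<tau>)) -
    \<tau> * ((real n - 1) * exp (\<tau> * (real n - 1)) - (real n - 1) * exp (- \<tau>)) /
      (exp (\<tau> * (real n - 1)) + (real n - 1) * exp (- \<tau>))"
proof -
  let ?G = "complete_graph n"
  have "\<exists>U d. spectral_decomp (of_real_mat n (adj ?G)) U d \<and>
    (\<forall>g. (\<Sum>i<n. g (d i)) = (\<Sum>\<mu>\<in>{real n - 1}. g \<mu>)
      + (real n - real (card {real n - 1})) * (g (- 1) :: real))"
  proof (rule spectral_decomp_few_levels)
    fix \<mu> assume "\<mu> \<in> {real n - 1}"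
    moreover have "(\<Sum>j<n. adj ?G i j * 1) = (real n - 1) * 1" if "i < n" for i
      using sum_adj_row[of ?G i] that n by (simp add: degree_complete_graph of_nat_diff)
    ultimately show "\<exists>v. (\<exists>i<n. v i \<noteq> 0) \<and> (\<forall>i<n. (\<Sum>j<n. adj ?G i j * v j) = \<mu> * v i)"
      using n by (intro exI[of _ "\<lambda>_. 1"] conjI exI[of _ 0]) auto
  next
    have "(\<Sum>i<n. \<Sum>j<n. (adj ?G i j - (if i = j then - 1 else 0))\<^sup>2) = (\<Sum>i<n. \<Sum>j<n. 1)"
      by (intro sum.cong refl) (auto simp: adj_complete_graph)
    then show "(\<Sum>i<n. \<Sum>j<n. (adj ?G i j - (if i = j then - 1 else 0))\<^sup>2)
        = (\<Sum>\<mu>\<in>{real n - 1}. (\<mu> - - 1)\<^sup>2)"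
      by (simp add: power2_eq_square)
  qed (simp_all add: adj_sym)
  then obtain U d where dec: "spectral_decomp (adjacency_matrix ?G) U d"
    and g: "\<And>g :: real \<Rightarrow> real. (\<Sum>i<n. g (d i)) = g (real n - 1) + (real n - 1) * g (- 1)"
    by (auto simp: adjacency_matrix_eq)
  show ?thesis
    using entropy_adj_eq[OF _ dec, of \<tau>] n g[of "\<lambda>x. exp (- (- \<tau>) * x)"]
      g[of "\<lambda>x. x * exp (- (- \<tau>) * x)"]
    by (simp add: spectral_entropy_def)
qed

lemma entropy_lap_complete_graph:
  "n \<ge> 1 \<Longrightarrow> entropy_lap \<tau> (complete_graph n) = entropy_adj \<tau> (complete_graph n)"
  by (rule entropy_lap_regular[of _ "n - 1"]) (simp_all add: degree_complete_graph)

lemma entropy_nlap_complete_graph: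
  assumes "n \<ge> 2"
  shows "entropy_nlap \<tau> (complete_graph n) = entropy_adj (\<tau> / (real n - 1)) (complete_graph n)"
  by (rule entropy_nlap_const_degree_product)
    (use assms in \<open>auto simp: degree_complete_graph simple_complete_graph power2_eq_square of_nat_diff\<close>)

section \<open>Complete bipartite graphs\<close>

lemma order_complete_bipartite [simp]: "order_of (complete_bipartite n1 n2) = n1 + n2"
  by (simp add: complete_bipartite_def)

lemma adj_complete_bipartite:
  "i < n1 + n2 \<Longrightarrow> j < n1 + n2 \<Longrightarrow>
    adj (complete_bipartite n1 n2) i j = of_bool ((i < n1) \<noteq> (j < n1))"
  by (auto simp: adj_def complete_bipartite_def doubleton_eq_iff) (metis not_less)+

lemma sum_two_parts:
  "(\<Sum>j<n1 + n2. if j < n1 then x else y) = real n1 * x + real n2 * y"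
proof -
  have "{..<n1 + n2} \<inter> {j. j < n1} = {..<n1}" "{..<n1 + n2} \<inter> - {j. j < n1} = {n1..<n1 + n2}"
    by auto
  then show ?thesis by (simp add: sum.If_cases)
qed

lemma sum_adj_complete_bipartite:
  assumes "i < n1 + n2"
  shows "(\<Sum>j<n1 + n2. adj (complete_bipartite n1 n2) i j * (if j < n1 then x else y))
    = (if i < n1 then real n2 * y else real n1 * x)"
proof -
  have "(\<Sum>j<n1 + n2. adj (complete_bipartite n1 n2) i j * (if j < n1 then x else y))
    = (\<Sum>j<n1 + n2. if j < n1 then (if i < n1 then 0 else x) else (if i < n1 then y else 0))"
    by (intro sum.cong refl) (auto simp: adj_complete_bipartite assms)
  then show ?thesis by (simp add: sum_two_parts)
qed

lemma degree_complete_bipartite: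
  assumes "i < n1 + n2"
  shows "degree_of (complete_bipartite n1 n2) i = (if i < n1 then n2 else n1)"
proof -
  have "real (degree_of (complete_bipartite n1 n2) i) = real (if i < n1 then n2 else n1)"
    using sum_adj_row[of "complete_bipartite n1 n2" i] sum_adj_complete_bipartite[OF assms, of 1 1]
    by simp
  then show ?thesis by (simp only: of_nat_eq_iff)
qed

text \<open>The eigenvalues are \<open>s\<close> and \<open>- s\<close>, with eigenvectors constant on both parts, and otherwise \<open>0\<close>; the
  squares of the former already add up to the number \<open>2 * n1 * n2\<close> of nonzero entries.\<close>

lemma entropy_adj_complete_bipartite:
  assumes n: "n1 \<ge> 1" "n2 \<ge> 1" and s: "s = sqrt (real n1 * real n2)"
  shows "entropy_adj \<tau> (complete_bipartite n1 n2) =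
    ln (exp (\<tau> * s) + exp (- (\<tau> * s)) + (real n1 + real n2 - 2)) -
    \<tau> * s * (exp (\<tau> * s) - exp (- (\<tau> * s))) /
      (exp (\<tau> * s) + exp (- (\<tau> * s)) + (real n1 + real n2 - 2))"
proof -
  let ?G = "complete_bipartite n1 n2"
  let ?n = "n1 + n2"
  have s0: "s > 0" and ss: "s * s = real n1 * real n2" using n by (auto simp: s)
  have "\<exists>U d. spectral_decomp (of_real_mat ?n (adj ?G)) U d \<and>
    (\<forall>g. (\<Sum>i<?n. g (d i)) = (\<Sum>\<mu>\<in>{s, - s}. g \<mu>)
      + (real ?n - real (card {s, - s})) * (g 0 :: real))"
  proof (rule spectral_decomp_few_levels)
    \<comment> \<open>the vector with entries \<open>n2\<close> on the first part and \<open>\<mu>\<close> on the second serves both signs\<close>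
    fix \<mu> assume "\<mu> \<in> {s, - s}"
    then have mm: "\<mu> * \<mu> = real n1 * real n2" using ss by auto
    have "(\<Sum>j<?n. adj ?G i j * (if j < n1 then real n2 else \<mu>)) = \<mu> * (if i < n1 then real n2 else \<mu>)"
      if "i < ?n" for i
      using sum_adj_complete_bipartite[OF that] mm by simp
    then show "\<exists>v. (\<exists>i<?n. v i \<noteq> 0) \<and> (\<forall>i<?n. (\<Sum>j<?n. adj ?G i j * v j) = \<mu> * v i)"
      using n by (intro exI[of _ "\<lambda>i. if i < n1 then real n2 else \<mu>"] conjI exI[of _ 0]) auto
  next
    have "(\<Sum>i<?n. \<Sum>j<?n. (adj ?G i j - (if i = j then 0 else 0))\<^sup>2) = (\<Sum>i<?n. if i < n1 then real n2 else real n1)"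
      using sum_adj_complete_bipartite[of _ n1 n2 1 1] by (intro sum.cong refl) simp
    also have "\<dots> = 2 * (s * s)" by (simp add: sum_two_parts ss)
    finally show "(\<Sum>i<?n. \<Sum>j<?n. (adj ?G i j - (if i = j then 0 else 0))\<^sup>2)
        = (\<Sum>\<mu>\<in>{s, - s}. (\<mu> - 0)\<^sup>2)"
      using s0 by (simp add: power2_eq_square)
  qed (simp_all add: adj_sym)
  moreover have "card {s, - s} = 2" using s0 by simp
  ultimately obtain U d where dec: "spectral_decomp (adjacency_matrix ?G) U d"
    and g: "\<And>g :: real \<Rightarrow> real. (\<Sum>i<?n. g (d i)) = g s + g (- s) + (real n1 + real n2 - 2) * g 0"
    using s0 by (auto simp: adjacency_matrix_eq)
  have Z: "(\<Sum>i<?n. exp (- (- \<tau>) * d i)) = exp (\<tau> * s) + exp (- (\<tau> * s)) + (real n1 + real n2 - 2)"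
    using g[of "\<lambda>x. exp (- (- \<tau>) * x)"] by simp
  have M: "(\<Sum>i<?n. d i * exp (- (- \<tau>) * d i)) = s * (exp (\<tau> * s) - exp (- (\<tau> * s)))"
    using g[of "\<lambda>x. x * exp (- (- \<tau>) * x)"] by (simp add: algebra_simps)
  have "entropy_adj \<tau> ?G = spectral_entropy ?n (- \<tau>) d"
    using entropy_adj_eq[OF _ dec] n by simp
  then show ?thesis
    unfolding spectral_entropy_def Z M by (simp add: mult.assoc)
qed

text \<open>The Laplacian has the eigenvalue \<open>0\<close> for the vector of ones and \<open>n + 1\<close> for the vector that is \<open>1\<close>
  on the leaves and \<open>- n\<close> at the centre, which is the vertex \<open>n\<close>; all other eigenvalues are \<open>1\<close>.\<close>

lemma entropy_lap_star:
  assumes n: "n \<ge> 1"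
  shows "entropy_lap \<tau> (complete_bipartite n 1) =
    ln (1 + exp (- \<tau> * (real n + 1)) + (real n - 1) * exp (- \<tau>)) +
    \<tau> * ((real n + 1) * exp (- \<tau> * (real n + 1)) + (real n - 1) * exp (- \<tau>)) /
      (1 + exp (- \<tau> * (real n + 1)) + (real n - 1) * exp (- \<tau>))"
proof -
  let ?G = "complete_bipartite n 1"
  let ?n = "n + 1"
  let ?L = "\<lambda>i j. (if i = j then real (degree_of ?G i) else 0) - adj ?G i j"
  have L: "laplacian ?G = of_real_mat ?n ?L"
    using laplacian_eq[of ?G] by (simp only: order_complete_bipartite)
  have "\<exists>U d. spectral_decomp (of_real_mat ?n ?L) U d \<and>
    (\<forall>g. (\<Sum>i<?n. g (d i)) = (\<Sum>\<mu>\<in>{0, real n + 1}. g \<mu>)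
      + (real ?n - real (card {0, real n + 1})) * (g 1 :: real))"
  proof (rule spectral_decomp_few_levels)
    show "?L i j = ?L j i" for i j by (simp add: adj_sym)
  next
    have Lv: "(\<Sum>j<?n. ?L i j * (if j < n then x else y)) = (if i < n then x - y else real n * (y - x))"
      if i: "i < ?n" for i x y
    proof -
      have "(\<Sum>j<?n. ?L i j * (if j < n then x else y))
          = (\<Sum>j<?n. if i = j then real (degree_of ?G i) * (if i < n then x else y) else 0)
            - (\<Sum>j<?n. adj ?G i j * (if j < n then x else y))"
        unfolding sum_subtractf[symmetric] by (intro sum.cong refl) (auto simp: algebra_simps)
      also have "\<dots> = real (degree_of ?G i) * (if i < n then x else y)
          - (\<Sum>j<?n. adj ?G i j * (if j < n then x else y))"
        using i by simp
      also have "\<dots> = (if i < n then x - y else real n * (y - x))"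
        unfolding sum_adj_complete_bipartite[OF i] using degree_complete_bipartite[OF i]
        by (simp add: algebra_simps)
      finally show ?thesis .
    qed
    \<comment> \<open>the entry \<open>1 - \<mu>\<close> at the centre is \<open>1\<close> for \<open>\<mu> = 0\<close> and \<open>- n\<close> for \<open>\<mu> = n + 1\<close>\<close>
    fix \<mu> assume "\<mu> \<in> {0, real n + 1}"
    then have "\<forall>i<?n. (\<Sum>j<?n. ?L i j * (if j < n then 1 else 1 - \<mu>)) = \<mu> * (if i < n then 1 else 1 - \<mu>)"
      using Lv[of _ 1 "1 - \<mu>"] by auto
    then show "\<exists>v. (\<exists>i<?n. v i \<noteq> 0) \<and> (\<forall>i<?n. (\<Sum>j<?n. ?L i j * v j) = \<mu> * v i)"
      using n by (intro exI[of _ "\<lambda>i. if i < n then 1 else 1 - \<mu>"] conjI exI[of _ 0]) auto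
  next
    have "(\<Sum>j<?n. (?L i j - (if i = j then 1 else 0))\<^sup>2)
        = (if i < n then 1 else (real n - 1)\<^sup>2 + real n)" if i: "i < ?n" for i
    proof -
      have "(\<Sum>j<?n. (?L i j - (if i = j then 1 else 0))\<^sup>2)
          = (\<Sum>j<?n. (if i = j then (real (degree_of ?G i) - 1)\<^sup>2 else 0) + adj ?G i j)"
        by (intro sum.cong refl) (auto simp: simple_complete_bipartite)
      also have "\<dots> = (real (degree_of ?G i) - 1)\<^sup>2 + real (degree_of ?G i)"
        using i sum_adj_row[of ?G i] by (simp add: sum.distrib)
      also have "\<dots> = (if i < n then 1 else (real n - 1)\<^sup>2 + real n)"
        using degree_complete_bipartite[OF i] by simp
      finally show ?thesis .
    qed
    then have "(\<Sum>i<?n. \<Sum>j<?n. (?L i j - (if i = j then 1 else 0))\<^sup>2)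
        = (\<Sum>i<n + 1. if i < n then 1 else (real n - 1)\<^sup>2 + real n)"
      by (intro sum.cong) auto
    also have "\<dots> = (\<Sum>\<mu>\<in>{0, real n + 1}. (\<mu> - 1)\<^sup>2)"
      unfolding sum_two_parts by (simp add: power2_eq_square algebra_simps)
    finally show "(\<Sum>i<?n. \<Sum>j<?n. (?L i j - (if i = j then 1 else 0))\<^sup>2)
        = (\<Sum>\<mu>\<in>{0, real n + 1}. (\<mu> - 1)\<^sup>2)" .
  qed simp
  then obtain U d where dec: "spectral_decomp (laplacian ?G) U d"
    and g: "\<And>g :: real \<Rightarrow> real. (\<Sum>i<?n. g (d i)) = g 0 + g (real n + 1) + (real n - 1) * g 1"
    unfolding L by (auto simp: algebra_simps)
  have "entropy_lap \<tau> ?G = spectral_entropy ?n \<tau> d"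
    unfolding entropy_lap_def
    by (rule von_neumann_entropy_gibbs_state[OF _ _ dec]) (simp_all add: laplacian_eq)
  moreover have "(\<Sum>i<?n. exp (- \<tau> * d i))
      = 1 + exp (- \<tau> * (real n + 1)) + (real n - 1) * exp (- \<tau>)"
    using g[of "\<lambda>x. exp (- \<tau> * x)"] by simp
  moreover have "(\<Sum>i<?n. d i * exp (- \<tau> * d i))
      = (real n + 1) * exp (- \<tau> * (real n + 1)) + (real n - 1) * exp (- \<tau>)"
    using g[of "\<lambda>x. x * exp (- \<tau> * x)"] by simp
  ultimately show ?thesis by (simp only: spectral_entropy_def)
qed

lemma entropy_lap_balanced_bipartite:
  "n \<ge> 1 \<Longrightarrow> entropy_lap \<tau> (complete_bipartite n n) = entropy_adj \<tau> (complete_bipartite n n)"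
  by (rule entropy_lap_regular[of _ n]) (simp_all add: degree_complete_bipartite)

text \<open>Normalization rescales the eigenvalue \<open>sqrt (n1 * n2)\<close> to \<open>1\<close>, so the two exceptional levels keep
  bounded weights.\<close>

lemma entropy_nlap_complete_bipartite:
  assumes n: "n1 \<ge> 1" "n2 \<ge> 1"
  shows "entropy_nlap \<tau> (complete_bipartite n1 n2) =
    ln (exp \<tau> + exp (- \<tau>) + (real n1 + real n2 - 2)) -
    \<tau> * (exp \<tau> - exp (- \<tau>)) / (exp \<tau> + exp (- \<tau>) + (real n1 + real n2 - 2))"
proof -
  define s where "s = sqrt (real n1 * real n2)"
  have s: "s > 0" using n by (simp add: s_def)
  have "entropy_nlap \<tau> (complete_bipartite n1 n2) = entropy_adj (\<tau> / s) (complete_bipartite n1 n2)"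
  proof (rule entropy_nlap_const_degree_product)
    fix i j
    assume "i < order_of (complete_bipartite n1 n2)" "j < order_of (complete_bipartite n1 n2)"
      and "{i, j} \<in> edges (complete_bipartite n1 n2)"
    then have ij: "i < n1 + n2" "j < n1 + n2" and "(i < n1) \<noteq> (j < n1)"
      using adj_complete_bipartite[of i n1 n2 j] by (auto simp: adj_def)
    then show "real (degree_of (complete_bipartite n1 n2) i) * real (degree_of (complete_bipartite n1 n2) j) = s\<^sup>2"
      unfolding degree_complete_bipartite[OF ij(1)] degree_complete_bipartite[OF ij(2)]
      by (auto simp: s_def)
  qed (use n s in \<open>auto simp: degree_complete_bipartite simple_complete_bipartite\<close>)
  also have "\<dots> = ln (exp \<tau> + exp (- \<tau>) + (real n1 + real n2 - 2)) -
    \<tau> * (exp \<tau> - exp (- \<tau>)) / (exp \<tau> + exp (- \<tau>) + (real n1 + real n2 - 2))"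
    using entropy_adj_complete_bipartite[OF n s_def, of "\<tau> / s"] s by simp
  finally show ?thesis .
qed

text \<open>The upper bound depends on the sizes only through \<open>s\<close>, since \<open>(n1 - 1) * (n2 - 1) \<ge> 0\<close> bounds the
  multiplicity \<open>n1 + n2 - 2\<close> of the eigenvalue \<open>0\<close> by \<open>s\<^sup>2\<close>. This turns a limit in two variables
  into one in \<open>s\<close>.\<close>

lemma entropy_adj_complete_bipartite_bounds:
  assumes n: "n1 \<ge> 1" "n2 \<ge> 1" and s: "s = sqrt (real n1 * real n2)" and \<tau>: "\<tau> > 0"
  shows "0 \<le> entropy_adj \<tau> (complete_bipartite n1 n2)"
    and "entropy_adj \<tau> (complete_bipartite n1 n2) \<le>
      ln (1 + exp (- (2 * \<tau> * s)) + s\<^sup>2 * exp (- (\<tau> * s))) +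
      \<tau> * s * (2 * exp (- (\<tau> * s)) + s\<^sup>2) * exp (- (\<tau> * s))"
proof -
  define x where "x = exp (\<tau> * s)"
  define y where "y = exp (- (\<tau> * s))"
  define m where "m = real n1 + real n2 - 2"
  have s0: "s \<ge> 0" and ss: "s\<^sup>2 = real n1 * real n2" using n by (auto simp: s)
  have x0: "x > 0" and y0: "y > 0" and xy: "x * y = 1" and yy: "y * y = exp (- (2 * \<tau> * s))"
    by (simp_all add: x_def y_def flip: exp_add)
  have m0: "m \<ge> 0" using n by (simp add: m_def)
  have ms: "m \<le> s\<^sup>2"
  proof -
    have "0 \<le> (real n1 - 1) * (real n2 - 1)" using n by simp
    then show ?thesis by (simp add: algebra_simps m_def ss)
  qed
  define Z where "Z = x + y + m"
  have Z0: "Z > 0" and xZ: "x \<le> Z" using x0 y0 m0 by (auto simp: Z_def)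
  have lnx: "ln x = \<tau> * s" by (simp add: x_def)
  have ent: "entropy_adj \<tau> (complete_bipartite n1 n2) = ln Z - \<tau> * s * (x - y) / Z"
    using entropy_adj_complete_bipartite[OF n s] by (simp add: x_def y_def m_def Z_def)
  have "\<tau> * s * (x - y) / Z \<le> \<tau> * s"
  proof -
    have "\<tau> * s * (x - y) \<le> \<tau> * s * Z"
      using \<tau> s0 y0 m0 by (intro mult_left_mono) (auto simp: Z_def)
    then show ?thesis using Z0 by (simp add: pos_divide_le_eq)
  qed
  moreover have "\<tau> * s \<le> ln Z" using lnx xZ x0 by (metis ln_mono)
  ultimately show "0 \<le> entropy_adj \<tau> (complete_bipartite n1 n2)" unfolding ent by linarith
  have "entropy_adj \<tau> (complete_bipartite n1 n2) = ln (Z * y) + \<tau> * s * (2 * y + m) / Z"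
  proof -
    have "ln y = - (\<tau> * s)" by (simp add: y_def)
    then have l: "ln (Z * y) = ln Z - \<tau> * s" using Z0 y0 by (simp add: ln_mult)
    have diff: "x - y = Z - (2 * y + m)" by (simp add: Z_def)
    have "\<tau> * s * (x - y) / Z = \<tau> * s - \<tau> * s * (2 * y + m) / Z"
      unfolding diff using Z0 by (simp add: field_simps)
    then show ?thesis unfolding ent l by simp
  qed
  also have "\<dots> \<le> ln (1 + y * y + s\<^sup>2 * y) + \<tau> * s * (2 * y + s\<^sup>2) * y"
  proof (rule add_mono)
    have "Z * y = 1 + y * y + m * y" using xy by (simp add: Z_def algebra_simps)
    also have "\<dots> \<le> 1 + y * y + s\<^sup>2 * y" using ms y0 by simp
    finally have "Z * y \<le> 1 + y * y + s\<^sup>2 * y" .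
    then show "ln (Z * y) \<le> ln (1 + y * y + s\<^sup>2 * y)"
      by (rule ln_mono[OF _ mult_pos_pos[OF Z0 y0]])
    have "\<tau> * s * (2 * y + m) / Z \<le> \<tau> * s * (2 * y + m) / x"
      using xZ x0 Z0 \<tau> s0 y0 m0 by (intro divide_left_mono) auto
    also have "\<dots> = \<tau> * s * (2 * y + m) * y" using xy x0 by (simp add: field_simps)
    also have "\<dots> \<le> \<tau> * s * (2 * y + s\<^sup>2) * y"
      using ms \<tau> s0 y0 by (intro mult_right_mono mult_left_mono) auto
    finally show "\<tau> * s * (2 * y + m) / Z \<le> \<tau> * s * (2 * y + s\<^sup>2) * y" .
  qed
  finally show "entropy_adj \<tau> (complete_bipartite n1 n2) \<le>
      ln (1 + exp (- (2 * \<tau> * s)) + s\<^sup>2 * exp (- (\<tau> * s))) +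
      \<tau> * s * (2 * exp (- (\<tau> * s)) + s\<^sup>2) * exp (- (\<tau> * s))"
    unfolding yy unfolding y_def .
qed

section \<open>Regular graphs of fixed degree\<close>

text \<open>Up to the factor \<open>exp y\<close>, the right-hand side is the error of the tangent at \<open>0\<close> to the exponential
  function, evaluated at \<open>- y\<close>. With \<open>x = exp y\<close> it is \<open>x ln x - x + 1\<close>, the integrand of relative
  entropy, so the estimate is a quantitative form of its strict convexity.\<close>

lemma exp_tangent_gap:
  fixes y :: real
  shows "y\<^sup>2 / 2 * exp (- 2 * \<bar>y\<bar>) \<le> y * exp y - exp y + 1"
proof -
  obtain t where t: "\<bar>t\<bar> \<le> \<bar>- y\<bar>"
    and e: "exp (- y) = (\<Sum>m<2. (- y) ^ m / fact m) + exp t / fact 2 * (- y) ^ 2"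
    using Maclaurin_exp_le[of "- y" 2] by blast
  have e2: "exp (- y) = 1 - y + exp t / 2 * y\<^sup>2"
    using e by (simp add: eval_nat_numeral)
  have "y * exp y - exp y + 1 = exp y * (y - 1 + exp (- y))"
    by (simp add: algebra_simps exp_minus_inverse)
  also have "\<dots> = y\<^sup>2 / 2 * exp (y + t)"
    unfolding e2 by (simp add: exp_add)
  finally have "y * exp y - exp y + 1 = y\<^sup>2 / 2 * exp (y + t)" .
  moreover have "- 2 * \<bar>y\<bar> \<le> y + t" using t by linarith
  ultimately show ?thesis by (simp add: mult_left_mono)
qed

text \<open>The deficit is the relative entropy between the state and the uniform distribution. Let
  \<open>exp (\<tau> b)\<close> be the mean of the weights \<open>exp (\<tau> a i)\<close> and \<open>y i = \<tau> (a i - b)\<close>, so that \<open>exp (y i)\<close> is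
  the density of the state with mean \<open>1\<close>. Then the deficit is the mean of
  \<open>y i exp (y i) - exp (y i) + 1\<close>, and the tangent estimate bounds it below by a multiple of the mean
  of \<open>(a i - b)\<^sup>2\<close>, which is at least the variance \<open>v\<close>. The upper bound uses that the partition
  function is at least \<open>n\<close>, by convexity and mean \<open>0\<close>.\<close>

lemma entropy_deficit_bounds:
  fixes a :: "nat \<Rightarrow> real"
  assumes n: "n > 0" and \<tau>: "\<tau> > 0" and bd: "\<And>i. i < n \<Longrightarrow> \<bar>a i\<bar> \<le> r"
    and s0: "(\<Sum>i<n. a i) = 0" and s2: "(\<Sum>i<n. (a i)\<^sup>2) = real n * v"
  shows "ln (real n) - spectral_entropy n (- \<tau>) a \<le> \<tau> * r"
    and "\<tau>\<^sup>2 * v / 2 * exp (- 4 * \<tau> * r) \<le> ln (real n) - spectral_entropy n (- \<tau>) a"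
proof -
  define Z where "Z = (\<Sum>i<n. exp (\<tau> * a i))"
  define M where "M = (\<Sum>i<n. a i * exp (\<tau> * a i))"
  have Z0: "Z > 0" unfolding Z_def using n by (intro sum_pos) auto
  have S: "ln (real n) - spectral_entropy n (- \<tau>) a = \<tau> * M / Z - ln (Z / real n)"
    using n Z0 by (simp add: spectral_entropy_def Z_def[symmetric] M_def[symmetric] ln_div)
  have Zn: "real n \<le> Z"
  proof -
    have "real n = (\<Sum>i<n. 1 + \<tau> * a i)"
      by (simp add: sum.distrib s0 flip: sum_distrib_left)
    also have "\<dots> \<le> Z" unfolding Z_def by (intro sum_mono exp_ge_add_one_self)
    finally show ?thesis .
  qed
  have "M \<le> r * Z"
    unfolding M_def Z_def sum_distrib_left
    by (intro sum_mono mult_right_mono) (use bd in \<open>auto simp: abs_le_iff\<close>)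
  then have "\<tau> * M / Z \<le> \<tau> * r" using Z0 \<tau> by (simp add: field_simps)
  moreover have "ln (Z / real n) \<ge> 0" using Zn n by simp
  ultimately show "ln (real n) - spectral_entropy n (- \<tau>) a \<le> \<tau> * r" unfolding S by linarith
  define b where "b = ln (Z / real n) / \<tau>"
  have eb: "exp (\<tau> * b) = Z / real n" unfolding b_def using \<tau> Z0 n by simp
  have b0: "b \<ge> 0" unfolding b_def using Zn n \<tau> by simp
  have br: "b \<le> r"
  proof -
    have "Z \<le> (\<Sum>i<n. exp (\<tau> * r))"
      unfolding Z_def using \<tau> bd by (intro sum_mono) (auto simp: abs_le_iff)
    then have "exp (\<tau> * b) \<le> exp (\<tau> * r)" unfolding eb using n by (simp add: field_simps)
    then show ?thesis using \<tau> by simp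
  qed
  define y where "y i = \<tau> * (a i - b)" for i
  have ey: "exp (y i) = real n * exp (\<tau> * a i) / Z" for i
    unfolding y_def right_diff_distrib exp_diff eb by simp
  have sum_ey: "(\<Sum>i<n. exp (y i)) = real n"
    unfolding ey using Z0 by (simp add: Z_def flip: sum_divide_distrib sum_distrib_left)
  have sum_aey: "(\<Sum>i<n. a i * exp (y i)) = real n * M / Z"
    unfolding ey M_def by (simp add: sum_distrib_left sum_divide_distrib mult_ac)
  have "(\<Sum>i<n. y i * exp (y i) - exp (y i) + 1) =
      \<tau> * (\<Sum>i<n. a i * exp (y i)) - \<tau> * b * (\<Sum>i<n. exp (y i)) - (\<Sum>i<n. exp (y i)) + real n"
    by (simp add: y_def sum.distrib sum_subtractf sum_distrib_left algebra_simps)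
  also have "\<dots> = real n * (\<tau> * M / Z - ln (Z / real n))"
    unfolding sum_aey sum_ey using \<tau> by (simp add: b_def algebra_simps)
  finally have gap: "(\<Sum>i<n. y i * exp (y i) - exp (y i) + 1)
      = real n * (ln (real n) - spectral_entropy n (- \<tau>) a)" unfolding S .
  have yb: "\<bar>y i\<bar> \<le> 2 * \<tau> * r" if "i < n" for i
  proof -
    have "\<bar>a i - b\<bar> \<le> 2 * r" using bd[OF that] b0 br by linarith
    then show ?thesis using \<tau> by (simp add: y_def abs_mult)
  qed
  have "real n * v \<le> (\<Sum>i<n. (a i - b)\<^sup>2)"
  proof -
    have "(\<Sum>i<n. (a i - b)\<^sup>2) = (\<Sum>i<n. (a i)\<^sup>2) - 2 * b * (\<Sum>i<n. a i) + real n * b\<^sup>2"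
      by (simp add: power2_diff sum.distrib sum_subtractf sum_distrib_left mult_ac)
    then show ?thesis by (simp add: s0 s2)
  qed
  then have "(\<tau>\<^sup>2 / 2 * exp (- 4 * \<tau> * r)) * (real n * v) \<le> (\<tau>\<^sup>2 / 2 * exp (- 4 * \<tau> * r)) * (\<Sum>i<n. (a i - b)\<^sup>2)"
    by (intro mult_left_mono) auto
  also have "\<dots> = (\<Sum>i<n. (y i)\<^sup>2 / 2 * exp (- 4 * \<tau> * r))"
    by (simp add: y_def sum_distrib_left power_mult_distrib mult_ac)
  also have "\<dots> \<le> (\<Sum>i<n. y i * exp (y i) - exp (y i) + 1)"
  proof (intro sum_mono)
    fix i assume "i \<in> {..<n}"
    then have "(y i)\<^sup>2 / 2 * exp (- 4 * \<tau> * r) \<le> (y i)\<^sup>2 / 2 * exp (- 2 * \<bar>y i\<bar>)"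
      using yb[of i] by (intro mult_left_mono) auto
    then show "(y i)\<^sup>2 / 2 * exp (- 4 * \<tau> * r) \<le> y i * exp (y i) - exp (y i) + 1"
      using exp_tangent_gap[of "y i"] by linarith
  qed
  finally have "real n * (\<tau>\<^sup>2 * v / 2 * exp (- 4 * \<tau> * r))
      \<le> real n * (ln (real n) - spectral_entropy n (- \<tau>) a)" unfolding gap by (simp add: mult_ac)
  then show "\<tau>\<^sup>2 * v / 2 * exp (- 4 * \<tau> * r) \<le> ln (real n) - spectral_entropy n (- \<tau>) a"
    using n by simp
qed

text \<open>Row sums bound the eigenvalues by \<open>k\<close>, the diagonal gives the mean \<open>0\<close>, and the number of nonzero
  entries gives the mean square \<open>k\<close>.\<close>

lemma entropy_adj_regular_bounds:
  assumes n: "order_of G > 0" and simple: "simple_graph G" and \<tau>: "\<tau> > 0"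
    and reg: "\<And>i. i < order_of G \<Longrightarrow> degree_of G i = k"
  shows "ln (real (order_of G)) - entropy_adj \<tau> G \<le> \<tau> * real k"
    and "\<tau>\<^sup>2 * real k / 2 * exp (- 4 * \<tau> * real k) \<le> ln (real (order_of G)) - entropy_adj \<tau> G"
proof -
  let ?n = "order_of G"
  obtain U a where dec: "spectral_decomp (of_real_mat ?n (adj G)) U a"
    using spectral_decomp_of_real_mat_exists[of ?n "adj G", OF adj_sym] by blast
  have row: "(\<Sum>j<?n. adj G i j) = real k" if "i < ?n" for i
    using sum_adj_row[of G i] reg[OF that] by simp
  have "(\<Sum>j<?n. \<bar>adj G i j\<bar>) \<le> real k" if "i < ?n" for i
    using row[OF that] by (simp add: adj_def)
  then have bd: "\<bar>a l\<bar> \<le> real k" if "l < ?n" for l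
    using abs_eigenvalue_le_row_sum[OF dec that] by blast
  have s0: "(\<Sum>i<?n. a i) = 0"
    using sum_eigenvalues_of_real_mat[OF dec] simple by simp
  have s2: "(\<Sum>i<?n. (a i)\<^sup>2) = real ?n * real k"
    using sum_eigenvalues_centered_squared[OF dec adj_sym, of 0] row by simp
  have e: "entropy_adj \<tau> G = spectral_entropy ?n (- \<tau>) a"
    using entropy_adj_eq[OF n] dec by (simp add: adjacency_matrix_eq)
  show "ln (real ?n) - entropy_adj \<tau> G \<le> \<tau> * real k"
    and "\<tau>\<^sup>2 * real k / 2 * exp (- 4 * \<tau> * real k) \<le> ln (real ?n) - entropy_adj \<tau> G"
    unfolding e using entropy_deficit_bounds[OF n \<tau> bd s0 s2] by blast+
qed

section \<open>Cycles\<close>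

lemma order_cycle_graph [simp]: "order_of (cycle_graph n) = n"
  by (simp add: cycle_graph_def)

lemma degree_cycle_graph:
  assumes n: "n \<ge> 3" and i: "i < n"
  shows "degree_of (cycle_graph n) i = 2"
proof -
  define p where "p = (if i = 0 then n - 1 else i - 1)"
  have succ: "Suc k mod n = (if Suc k = n then 0 else Suc k)" if "k < n" for k
    using that by auto
  have "{j. j < n \<and> {i, j} \<in> edges (cycle_graph n)} = {(i + 1) mod n, p}"
  proof (intro equalityI subsetI)
    fix j assume "j \<in> {j. j < n \<and> {i, j} \<in> edges (cycle_graph n)}"
    then obtain k where "k < n" "{i, j} = {k, Suc k mod n}" by (auto simp: cycle_graph_def)
    then show "j \<in> {(i + 1) mod n, p}"
      using i unfolding succ[OF \<open>k < n\<close>]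
      by (auto simp: doubleton_eq_iff p_def split: if_splits)
  next
    fix j assume j: "j \<in> {(i + 1) mod n, p}"
    have "p < n" "i = (p + 1) mod n" using n i by (auto simp: p_def)
    then have "{i, p} = {p, (p + 1) mod n}" by auto
    then show "j \<in> {j. j < n \<and> {i, j} \<in> edges (cycle_graph n)}"
      using j i n \<open>p < n\<close> by (auto simp: cycle_graph_def)
  qed
  moreover have "(i + 1) mod n \<noteq> p" using n i by (auto simp: succ p_def)
  ultimately show ?thesis by (simp add: degree_of_def cycle_graph_def)
qed

lemma entropy_lap_cycle_graph:
  "n \<ge> 3 \<Longrightarrow> entropy_lap \<tau> (cycle_graph n) = entropy_adj \<tau> (cycle_graph n)"
  by (rule entropy_lap_regular[of _ 2]) (simp_all add: degree_cycle_graph)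

lemma entropy_nlap_cycle_graph:
  assumes "n \<ge> 3"
  shows "entropy_nlap \<tau> (cycle_graph n) = entropy_adj (\<tau> / 2) (cycle_graph n)"
proof (rule entropy_nlap_const_degree_product)
  show "order_of (cycle_graph n) > 0" using assms by simp
  show "degree_of (cycle_graph n) i > 0" if "i < order_of (cycle_graph n)" for i
    using that degree_cycle_graph[OF assms] by simp
  show "real (degree_of (cycle_graph n) i) * real (degree_of (cycle_graph n) j) = 2\<^sup>2"
    if "i < order_of (cycle_graph n)" "j < order_of (cycle_graph n)" for i j
    using that degree_cycle_graph[OF assms] by simp
qed (use assms simple_cycle_graph in auto)

lemma entropy_deficit_cycle_graph:
  assumes "\<tau> > 0"
  shows "(\<lambda>n. ln (real n) - entropy_adj \<tau> (cycle_graph n)) \<in> \<Theta>(\<lambda>_. 1)"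
proof -
  let ?f = "\<lambda>n. ln (real n) - entropy_adj \<tau> (cycle_graph n)"
  let ?c = "\<tau>\<^sup>2 * exp (- 8 * \<tau>)"
  have c: "?c > 0" using assms by simp
  have bounds: "?c \<le> ?f n \<and> ?f n \<le> \<tau> * 2" if n: "n \<ge> 3" for n
    using entropy_adj_regular_bounds[OF _ simple_cycle_graph[OF n] assms, of 2] n degree_cycle_graph[OF n]
    by simp
  have ev: "eventually (\<lambda>n. ?c \<le> \<bar>?f n\<bar> \<and> \<bar>?f n\<bar> \<le> \<tau> * 2) sequentially"
  proof (rule eventually_sequentiallyI)
    fix n :: nat assume "n \<ge> 3"
    from bounds[OF this] c show "?c \<le> \<bar>?f n\<bar> \<and> \<bar>?f n\<bar> \<le> \<tau> * 2" by linarith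
  qed
  show ?thesis
  proof (rule bigthetaI)
    show "?f \<in> O(\<lambda>_. 1)"
      by (rule bigoI[of _ "\<tau> * 2"], rule eventually_mono[OF ev]) simp
    show "?f \<in> \<Omega>(\<lambda>_. 1)"
      by (rule landau_omega.bigI[OF c], rule eventually_mono[OF ev]) simp
  qed
qed

section \<open>Limits along the graph families\<close>

lemma smallo_1_if_tendsto_0: "(f \<longlongrightarrow> 0) F \<Longrightarrow> f \<in> o[F](\<lambda>_. 1 :: real)" for f :: "_ \<Rightarrow> real"
  by (rule smalloI_tendsto) simp_all

abbreviation bipartite_sizes :: "(nat \<times> nat) filter" where
  "bipartite_sizes \<equiv> inf (filtercomap (\<lambda>(n1, n2). n1 + n2) at_top)
    (principal {(n1, n2). n1 \<ge> 1 \<and> n2 \<ge> 1})"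

lemma eventually_bipartite_sizes: "eventually (\<lambda>(n1, n2). n1 \<ge> 1 \<and> n2 \<ge> 1) bipartite_sizes"
  unfolding eventually_inf_principal by (rule always_eventually) auto

text \<open>Among sizes with a given sum \<open>n\<close>, the product is smallest for the star, where it is \<open>n - 1\<close>.\<close>

lemma filterlim_geometric_mean_sizes:
  "filterlim (\<lambda>(n1, n2). sqrt (real n1 * real n2)) at_top bipartite_sizes"
proof (rule filterlim_at_top_mono)
  have "filterlim (\<lambda>n. sqrt (real n - 1)) at_top sequentially" by real_asymp
  moreover have "filterlim (\<lambda>(n1, n2). n1 + n2) at_top bipartite_sizes"
    by (rule filterlim_mono[OF filterlim_filtercomap order_refl]) simp
  ultimately show "filterlim (\<lambda>p. sqrt (real ((\<lambda>(n1, n2). n1 + n2) p) - 1)) at_top bipartite_sizes"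
    by (rule filterlim_compose)
  have "sqrt (real (n1 + n2) - 1) \<le> sqrt (real n1 * real n2)" if "n1 \<ge> 1" "n2 \<ge> 1" for n1 n2
  proof -
    have "0 \<le> (real n1 - 1) * (real n2 - 1)" using that by simp
    then show ?thesis by (simp add: algebra_simps)
  qed
  then show "\<forall>\<^sub>F p in bipartite_sizes. sqrt (real ((\<lambda>(n1, n2). n1 + n2) p) - 1)
      \<le> (case p of (n1, n2) \<Rightarrow> sqrt (real n1 * real n2))"
    by (intro eventually_mono[OF eventually_bipartite_sizes]) auto
qed

lemma tendsto_entropy_adj_complete_bipartite:
  assumes "\<tau> > 0"
  shows "((\<lambda>(n1, n2). entropy_adj \<tau> (complete_bipartite n1 n2)) \<longlongrightarrow> 0) bipartite_sizes"
proof (rule tendsto_sandwich[where f = "\<lambda>_. 0"])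
  let ?h = "\<lambda>s :: real. ln (1 + exp (- (2 * \<tau> * s)) + s\<^sup>2 * exp (- (\<tau> * s))) +
      \<tau> * s * (2 * exp (- (\<tau> * s)) + s\<^sup>2) * exp (- (\<tau> * s))"
  have "(?h \<longlongrightarrow> 0) at_top" using assms by real_asymp
  then show "((\<lambda>p. ?h (case p of (n1, n2) \<Rightarrow> sqrt (real n1 * real n2))) \<longlongrightarrow> 0) bipartite_sizes"
    by (rule filterlim_compose[OF _ filterlim_geometric_mean_sizes])
  show "\<forall>\<^sub>F p in bipartite_sizes. (case p of (n1, n2) \<Rightarrow> entropy_adj \<tau> (complete_bipartite n1 n2))
      \<le> ?h (case p of (n1, n2) \<Rightarrow> sqrt (real n1 * real n2))"
    using entropy_adj_complete_bipartite_bounds(2)[OF _ _ refl assms]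
    by (intro eventually_mono[OF eventually_bipartite_sizes]) (auto simp del: real_sqrt_pow2_iff real_sqrt_mult)
  show "\<forall>\<^sub>F p in bipartite_sizes. 0 \<le> (case p of (n1, n2) \<Rightarrow> entropy_adj \<tau> (complete_bipartite n1 n2))"
    using entropy_adj_complete_bipartite_bounds(1)[OF _ _ refl assms]
    by (intro eventually_mono[OF eventually_bipartite_sizes]) auto
qed simp

lemma entropy_adj_complete_bipartite_along:
  assumes "\<tau> > 0" and "filterlim (\<lambda>n. f n + g n) at_top sequentially"
    and "eventually (\<lambda>n. f n \<ge> 1 \<and> g n \<ge> 1) sequentially"
  shows "(\<lambda>n. entropy_adj \<tau> (complete_bipartite (f n) (g n))) \<longlonglongrightarrow> 0"
proof -
  have "filterlim (\<lambda>n. (f n, g n)) bipartite_sizes sequentially"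
    using assms(2,3) by (auto simp: filterlim_inf filterlim_principal filterlim_filtercomap_iff o_def)
  from filterlim_compose[OF tendsto_entropy_adj_complete_bipartite[OF assms(1)] this]
  show ?thesis by simp
qed

lemma tendsto_entropy_adj_complete_graph:
  assumes "\<tau> > 0"
  shows "(\<lambda>n. entropy_adj \<tau> (complete_graph n)) \<longlonglongrightarrow> 0"
proof -
  have "(\<lambda>n. ln (exp (\<tau> * (real n - 1)) + (real n - 1) * exp (- \<tau>)) -
    \<tau> * ((real n - 1) * exp (\<tau> * (real n - 1)) - (real n - 1) * exp (- \<tau>)) /
      (exp (\<tau> * (real n - 1)) + (real n - 1) * exp (- \<tau>))) \<longlonglongrightarrow> 0"
    using assms by real_asymp
  then show ?thesis
    by (rule Lim_transform_eventually)
      (auto intro!: eventually_sequentiallyI[of 2] simp: entropy_adj_complete_graph)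
qed

lemma tendsto_deficit_nlap_complete_graph:
  assumes "\<tau> > 0"
  shows "(\<lambda>n. ln (real n) - entropy_nlap \<tau> (complete_graph n)) \<longlonglongrightarrow> 0"
proof -
  have "(\<lambda>n. ln (real n) - (ln (exp (\<tau> / (real n - 1) * (real n - 1)) + (real n - 1) * exp (- (\<tau> / (real n - 1)))) -
    \<tau> / (real n - 1) * ((real n - 1) * exp (\<tau> / (real n - 1) * (real n - 1)) - (real n - 1) * exp (- (\<tau> / (real n - 1)))) /
      (exp (\<tau> / (real n - 1) * (real n - 1)) + (real n - 1) * exp (- (\<tau> / (real n - 1)))))) \<longlonglongrightarrow> 0"
    using assms by real_asymp
  then show ?thesis
    by (rule Lim_transform_eventually)
      (auto intro!: eventually_sequentiallyI[of 2]
        simp only: entropy_nlap_complete_graph entropy_adj_complete_graph)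
qed

theorem mainTheorem7:
  fixes \<tau> :: real
  assumes "\<tau> > 0"
  shows
    "((\<lambda>n. ln (real n) - entropy_adj \<tau> (empty_graph n)) \<in> o(\<lambda>_. 1) \<and>
      (\<lambda>n. ln (real n) - entropy_lap \<tau> (empty_graph n)) \<in> o(\<lambda>_. 1)) \<and>

     ((\<lambda>n. entropy_adj \<tau> (complete_graph n)) \<in> o(\<lambda>_. 1) \<and>
      (\<lambda>n. entropy_lap \<tau> (complete_graph n)) \<in> o(\<lambda>_. 1) \<and>
      (\<lambda>n. ln (real n) - entropy_nlap \<tau> (complete_graph n)) \<in> o(\<lambda>_. 1)) \<and>

     (\<lambda>(n1, n2). entropy_adj \<tau> (complete_bipartite n1 n2))
        \<in> o[inf (filtercomap (\<lambda>(n1, n2). n1 + n2) at_top)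
                (principal {(n1, n2). n1 \<ge> 1 \<and> n2 \<ge> 1})](\<lambda>_. 1) \<and>

     ((\<lambda>n1. entropy_adj \<tau> (complete_bipartite n1 n1)) \<in> o(\<lambda>_. 1) \<and>
      (\<lambda>n1. entropy_lap \<tau> (complete_bipartite n1 n1)) \<in> o(\<lambda>_. 1) \<and>
      (\<lambda>n1. ln (real (2 * n1)) - entropy_nlap \<tau> (complete_bipartite n1 n1)) \<in> o(\<lambda>_. 1)) \<and>

     ((\<lambda>n1. entropy_adj \<tau> (complete_bipartite n1 1)) \<in> o(\<lambda>_. 1) \<and>
      (\<lambda>n1. ln (real (n1 + 1)) - entropy_lap \<tau> (complete_bipartite n1 1)) \<in> o(\<lambda>_. 1) \<and>
      (\<lambda>n1. ln (real (n1 + 1)) - entropy_nlap \<tau> (complete_bipartite n1 1)) \<in> o(\<lambda>_. 1)) \<and>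

     ((\<lambda>n. ln (real n) - entropy_adj \<tau> (cycle_graph n)) \<in> \<Theta>(\<lambda>_. 1) \<and>
      (\<lambda>n. ln (real n) - entropy_lap \<tau> (cycle_graph n)) \<in> \<Theta>(\<lambda>_. 1) \<and>
      (\<lambda>n. ln (real n) - entropy_nlap \<tau> (cycle_graph n)) \<in> \<Theta>(\<lambda>_. 1))"
proof (intro conjI)
  have from1: "eventually (\<lambda>n. n \<ge> 1) (sequentially :: nat filter)"
    by (rule eventually_ge_at_top)
  show "(\<lambda>n. ln (real n) - entropy_adj \<tau> (empty_graph n)) \<in> o(\<lambda>_. 1)"
    by (intro smallo_1_if_tendsto_0 tendsto_eventually eventually_mono[OF from1])
      (simp add: entropy_empty_graph)
  show "(\<lambda>n. ln (real n) - entropy_lap \<tau> (empty_graph n)) \<in> o(\<lambda>_. 1)"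
    by (intro smallo_1_if_tendsto_0 tendsto_eventually eventually_mono[OF from1])
      (simp add: entropy_empty_graph)
  show "(\<lambda>n. entropy_adj \<tau> (complete_graph n)) \<in> o(\<lambda>_. 1)"
    by (rule smallo_1_if_tendsto_0[OF tendsto_entropy_adj_complete_graph[OF assms]])
  show "(\<lambda>n. entropy_lap \<tau> (complete_graph n)) \<in> o(\<lambda>_. 1)"
    by (rule smallo_1_if_tendsto_0,
        rule Lim_transform_eventually[OF tendsto_entropy_adj_complete_graph[OF assms]],
        rule eventually_mono[OF from1]) (simp add: entropy_lap_complete_graph)
  show "(\<lambda>n. ln (real n) - entropy_nlap \<tau> (complete_graph n)) \<in> o(\<lambda>_. 1)"
    by (rule smallo_1_if_tendsto_0[OF tendsto_deficit_nlap_complete_graph[OF assms]])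
  show "(\<lambda>(n1, n2). entropy_adj \<tau> (complete_bipartite n1 n2)) \<in> o[bipartite_sizes](\<lambda>_. 1)"
    by (rule smallo_1_if_tendsto_0[OF tendsto_entropy_adj_complete_bipartite[OF assms]])
  have bal: "(\<lambda>n. entropy_adj \<tau> (complete_bipartite n n)) \<longlonglongrightarrow> 0"
    by (rule entropy_adj_complete_bipartite_along[OF assms])
      (auto intro: filterlim_at_top_mono[OF filterlim_ident] eventually_mono[OF from1])
  then show "(\<lambda>n1. entropy_adj \<tau> (complete_bipartite n1 n1)) \<in> o(\<lambda>_. 1)"
    by (rule smallo_1_if_tendsto_0)
  show "(\<lambda>n1. entropy_lap \<tau> (complete_bipartite n1 n1)) \<in> o(\<lambda>_. 1)"
    by (rule smallo_1_if_tendsto_0, rule Lim_transform_eventually[OF bal],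
        rule eventually_mono[OF from1]) (simp add: entropy_lap_balanced_bipartite)
  have "(\<lambda>n. ln (real (2 * n)) - (ln (exp \<tau> + exp (- \<tau>) + (real n + real n - 2)) -
      \<tau> * (exp \<tau> - exp (- \<tau>)) / (exp \<tau> + exp (- \<tau>) + (real n + real n - 2)))) \<longlonglongrightarrow> 0"
    using assms by real_asymp
  then show "(\<lambda>n1. ln (real (2 * n1)) - entropy_nlap \<tau> (complete_bipartite n1 n1)) \<in> o(\<lambda>_. 1)"
    by (intro smallo_1_if_tendsto_0, elim Lim_transform_eventually)
      (rule eventually_mono[OF from1], simp only: entropy_nlap_complete_bipartite)
  show "(\<lambda>n1. entropy_adj \<tau> (complete_bipartite n1 1)) \<in> o(\<lambda>_. 1)"
    by (rule smallo_1_if_tendsto_0, rule entropy_adj_complete_bipartite_along[OF assms])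
      (auto intro: filterlim_at_top_mono[OF filterlim_ident] eventually_mono[OF from1])
  have "(\<lambda>n. ln (real (n + 1)) -
      (ln (1 + exp (- \<tau> * (real n + 1)) + (real n - 1) * exp (- \<tau>)) +
       \<tau> * ((real n + 1) * exp (- \<tau> * (real n + 1)) + (real n - 1) * exp (- \<tau>)) /
         (1 + exp (- \<tau> * (real n + 1)) + (real n - 1) * exp (- \<tau>)))) \<longlonglongrightarrow> 0"
    using assms by real_asymp
  then show "(\<lambda>n1. ln (real (n1 + 1)) - entropy_lap \<tau> (complete_bipartite n1 1)) \<in> o(\<lambda>_. 1)"
    by (intro smallo_1_if_tendsto_0, elim Lim_transform_eventually)
      (rule eventually_mono[OF from1], simp only: entropy_lap_star)
  have "(\<lambda>n. ln (real (n + 1)) - (ln (exp \<tau> + exp (- \<tau>) + (real n + real 1 - 2)) -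
      \<tau> * (exp \<tau> - exp (- \<tau>)) / (exp \<tau> + exp (- \<tau>) + (real n + real 1 - 2)))) \<longlonglongrightarrow> 0"
    using assms by real_asymp
  then show "(\<lambda>n1. ln (real (n1 + 1)) - entropy_nlap \<tau> (complete_bipartite n1 1)) \<in> o(\<lambda>_. 1)"
    by (intro smallo_1_if_tendsto_0, elim Lim_transform_eventually)
      (rule eventually_mono[OF from1], simp only: entropy_nlap_complete_bipartite order_refl)
  have from3: "eventually (\<lambda>n. n \<ge> 3) (sequentially :: nat filter)"
    by (rule eventually_ge_at_top)
  show "(\<lambda>n. ln (real n) - entropy_adj \<tau> (cycle_graph n)) \<in> \<Theta>(\<lambda>_. 1)"
    by (rule entropy_deficit_cycle_graph[OF assms])
  then show "(\<lambda>n. ln (real n) - entropy_lap \<tau> (cycle_graph n)) \<in> \<Theta>(\<lambda>_. 1)"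
    by (subst landau_theta.in_cong[OF eventually_mono[OF from3]])
      (simp_all add: entropy_lap_cycle_graph)
  have "(\<lambda>n. ln (real n) - entropy_adj (\<tau> / 2) (cycle_graph n)) \<in> \<Theta>(\<lambda>_. 1)"
    using assms by (intro entropy_deficit_cycle_graph) simp
  then show "(\<lambda>n. ln (real n) - entropy_nlap \<tau> (cycle_graph n)) \<in> \<Theta>(\<lambda>_. 1)"
    by (subst landau_theta.in_cong[OF eventually_mono[OF from3]])
      (simp_all add: entropy_nlap_cycle_graph)
qed

end
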